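(* Let $H$ be a fixed graph and let $a,b$ be positive integers. Then the threshold probability for Enforcer's win in the monotone $(a:b)$ Avoider-Enforcer vertex $H$-game played on $G\sim G(n,p)$ is $n^{-1/m(H)}$: if $p=\omega(n^{-1/m(H)})$ then w.h.p. Enforcer wins, and if $p=o(n^{-1/m(H)})$ then w.h.p. Avoider wins. Furthermore, if $H$ is strictly balanced, then there exists a constant $N=N(a,b,v(H))$ such that for the random graph process $\tilde G$, w.h.p. $\tau(\tilde G,\mathcal E)=\tau(\tilde G,\mathcal G_{NH})$, where $\mathcal E$ is the property of being Enforcer's win in the monotone $(a:b)$ Avoider-Enforcer vertex $H$-game.
   Context: For a graph $F$, $d(F)=e(F)/v(F)$, $m(F)=\max\{d(F'):F'\subseteq F\}$; $F$ is strictly balanced if $d(F)>d(F')$ for every proper subgraph $F'\subsetneq F$. The monotone $(a:b)$ Avoider-Enforcer vertex $H$-game on a graph $G$: Avoider and Enforcer alternately claim previously unclaimed vertices of $G$, Avoider claiming at least $a$ and Enforcer at least $b$ vertices per turn (the last player may claim fewer if not enough remain), until all are claimed; Avoider loses if the subgraph of $G$ induced by his vertices contains a (not necessarily induced) copy of $H$, and wins otherwise. $G(n,p)$ is the binomial random graph. The random graph process $\tilde G=(G_i)_{i=0}^{\binom n2}$ on $[n]$ adds the edges of $K_n$ one by one in uniformly random order; $\tau(\tilde G,\mathcal P)=\min\{i:G_i\in\mathcal P\}$. $\mathcal G_{NH}$ is the property of containing $N$ (possibly intersecting) copies of $H$. "W.h.p." means with probability tending to 1 as $n\to\infty$. The statement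 holds with either player moving first. *)

theory Defs
  imports "HOL-Analysis.Analysis" "HOL-Library.Landau_Symbols"
          "HOL-Combinatorics.Multiset_Permutations"
begin

definition is_graph :: "'a set \<Rightarrow> 'a set set \<Rightarrow> bool" where
  "is_graph V E \<longleftrightarrow> finite V \<and> (\<forall>e\<in>E. e \<subseteq> V \<and> card e = 2)"

definition subgraph :: "'a set \<Rightarrow> 'a set set \<Rightarrow> 'a set \<Rightarrow> 'a set set \<Rightarrow> bool" where
  "subgraph V' E' V E \<longleftrightarrow> V' \<subseteq> V \<and> E' \<subseteq> E \<and> (\<forall>e\<in>E'. e \<subseteq> V')"

definition density :: "'a set \<Rightarrow> 'a set set \<Rightarrow> real" where
  "density V E = real (card E) / real (card V)"

definition max_density :: "'a set \<Rightarrow> 'a set set \<Rightarrow> real" where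
  "max_density V E = Max {density V' E' | V' E'. V' \<noteq> {} \<and> subgraph V' E' V E}"

definition strictly_balanced :: "'a set \<Rightarrow> 'a set set \<Rightarrow> bool" where
  "strictly_balanced V E \<longleftrightarrow>
     (\<forall>V' E'. V' \<noteq> {} \<and> subgraph V' E' V E \<and> (V', E') \<noteq> (V, E)
        \<longrightarrow> density V' E' < density V E)"

definition copies :: "'h set \<Rightarrow> 'h set set \<Rightarrow> 'a set \<Rightarrow> 'a set set \<Rightarrow> ('a set \<times> 'a set set) set" where
  "copies VH EH V E = {(f ` VH, (\<lambda>e. f ` e) ` EH) | f.
       inj_on f VH \<and> f ` VH \<subseteq> V \<and> (\<forall>e\<in>EH. f ` e \<in> E)}"

definition contains_copy :: "'h set \<Rightarrow> 'h set set \<Rightarrow> 'a set \<Rightarrow> 'a set set \<Rightarrow> bool" where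
  "contains_copy VH EH V E \<longleftrightarrow> copies VH EH V E \<noteq> {}"

definition contains_N_copies :: "nat \<Rightarrow> 'h set \<Rightarrow> 'h set set \<Rightarrow> 'a set \<Rightarrow> 'a set set \<Rightarrow> bool" where
  "contains_N_copies N VH EH V E \<longleftrightarrow> N \<le> card (copies VH EH V E)"

definition induced_edges :: "'a set set \<Rightarrow> 'a set \<Rightarrow> 'a set set" where
  "induced_edges E S = {e \<in> E. e \<subseteq> S}"

datatype player = Avoider | Enforcer

text \<open>\<open>enf_wins a b VH EH E U A t\<close>: in the position where U is the set of unclaimed
  vertices, A is the set of vertices claimed by Avoider so far, and player t is to
  move, Enforcer has a winning strategy.  On his turn, Avoider claims a set S of
  at least a unclaimed vertices (all remaining ones if fewer than a remain);
  similarly Enforcer with b.  When all vertices are claimed, Enforcer has won iff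
  the subgraph induced by Avoider's vertices contains a copy of H.  Since every
  move claims at least one vertex, the game is finite and the least fixed point
  below is exactly the set of positions won by Enforcer.\<close>
inductive enf_wins :: "nat \<Rightarrow> nat \<Rightarrow> nat set \<Rightarrow> nat set set \<Rightarrow> nat set set
    \<Rightarrow> nat set \<Rightarrow> nat set \<Rightarrow> player \<Rightarrow> bool"
  for a b VH EH E where
  final: "contains_copy VH EH A (induced_edges E A) \<Longrightarrow> enf_wins a b VH EH E {} A t"
| avoider_move: "U \<noteq> {} \<Longrightarrow>
     (\<forall>S. S \<subseteq> U \<and> S \<noteq> {} \<and> min a (card U) \<le> card S
        \<longrightarrow> enf_wins a b VH EH E (U - S) (A \<union> S) Enforcer)
     \<Longrightarrow> enf_wins a b VH EH E U A Avoider"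
| enforcer_move: "U \<noteq> {} \<Longrightarrow> S \<subseteq> U \<Longrightarrow> S \<noteq> {} \<Longrightarrow> min b (card U) \<le> card S
     \<Longrightarrow> enf_wins a b VH EH E (U - S) A Avoider
     \<Longrightarrow> enf_wins a b VH EH E U A Enforcer"

definition enforcer_wins_game :: "nat \<Rightarrow> nat \<Rightarrow> player \<Rightarrow> nat set \<Rightarrow> nat set set
    \<Rightarrow> nat \<Rightarrow> nat set set \<Rightarrow> bool" where
  "enforcer_wins_game a b first VH EH n E = enf_wins a b VH EH E {0..<n} {} first"

definition pairs :: "nat \<Rightarrow> nat set set" where
  "pairs n = {e. e \<subseteq> {0..<n} \<and> card e = 2}"

definition gnp_prob :: "nat \<Rightarrow> real \<Rightarrow> (nat set set \<Rightarrow> bool) \<Rightarrow> real" where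
  "gnp_prob n p P = (\<Sum>E\<in>Pow (pairs n).
      if P E then p ^ card E * (1 - p) ^ (card (pairs n) - card E) else 0)"

text \<open>Random graph process: a uniformly random ordering \<sigma> of the edges of K_n;
  G_i has edge set \<open>set (take i \<sigma>)\<close>.  Hitting time (None if never hit).\<close>
definition hitting_time :: "nat set list \<Rightarrow> (nat set set \<Rightarrow> bool) \<Rightarrow> nat option" where
  "hitting_time \<sigma> P =
     (if \<exists>i\<le>length \<sigma>. P (set (take i \<sigma>)) then Some (LEAST i. P (set (take i \<sigma>))) else None)"

definition process_prob :: "nat \<Rightarrow> (nat set list \<Rightarrow> bool) \<Rightarrow> real" where
  "process_prob n Q = real (card {\<sigma> \<in> permutations_of_set (pairs n). Q \<sigma>})
                      / real (card (permutations_of_set (pairs n)))"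

end

theory Submission
  imports Defs "HOL-Real_Asymp.Real_Asymp"
begin

text \<open>
  Since the rules are monotone, on every move both players may take all vertices that lie in no copy
  of \<open>H\<close>.  Hence, if the copies of \<open>H\<close> in the graph are pairwise vertex-disjoint
  and enough other vertices exist, the outcome depends only on \<open>a\<close>, \<open>b\<close>, the first player,
  \<open>v(H)\<close> and the number of copies.  Enforcer wins when there are sufficiently many, and
  \<open>N\<close> is the least number with which he wins.

  If \<open>n * p powr m(H)\<close> tends to infinity, the second moment method yields a copy of the disjoint union of
  \<open>N\<close> copies of \<open>H\<close>, because this union has the same maximum density as \<open>H\<close>; if it tends to \<open>0\<close>, the
  first moment method excludes a densest subgraph of \<open>H\<close>.  For strictly balanced \<open>H\<close> with \<open>e\<close> edges
  and density \<open>d\<close>, the process is examined at edge density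
  \<open>n powr (- 1 / d + \<epsilon>)\<close> with \<open>\<epsilon> = 1 / (4 * e ^ 2)\<close>: there already are \<open>N\<close> copies, but with high probability
  no two copies intersect, so up to this time Enforcer wins exactly if there are \<open>N\<close> copies.
\<close>

section \<open>The game on an abstract winning condition\<close>

text \<open>The number of vertices outside all copies grows with \<open>n\<close>, so the game has
  to be compared with one on a fixed board of another type; \<open>gwins\<close> therefore replaces
  the graph by a condition \<open>P\<close> on Avoider's final set. Irrelevant vertices matter only
  for the first move, where they merely lift the restriction on its size. In the process, edge
  density \<open>n powr (- 1 / d)\<close> is too early: the expected number of copies is then of
  constant order, so \<open>N\<close> copies are not certain. A larger exponent makes them appear,
  and what limits it are pairs of intersecting copies. If the common part has \<open>j\<close>
  vertices and \<open>i\<close> edges and \<open>k\<close> is the number of vertices of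
  \<open>H\<close>, strict balance gives \<open>k * i < e * j\<close>; both sides are integers, so
  at \<open>n powr (- 1 / d)\<close> the expected number of such pairs is at most of order
  \<open>n powr (- 1 / e)\<close>. Raising the exponent by \<epsilon> costs at most a factor
  \<open>n powr (2 * e * \<epsilon>)\<close>, and \<epsilon> is chosen to spend half of the gain.
  Later times need no control: once \<open>N\<close> disjoint copies are present, both hitting times
  are decided.\<close>

inductive gwins :: "nat \<Rightarrow> nat \<Rightarrow> ('a set \<Rightarrow> bool) \<Rightarrow> 'a set \<Rightarrow> 'a set \<Rightarrow> player \<Rightarrow> bool"
  for a b P where
  final: "P A \<Longrightarrow> gwins a b P {} A t"
| avoider_move: "U \<noteq> {} \<Longrightarrow>
     (\<forall>S. S \<subseteq> U \<and> S \<noteq> {} \<and> min a (card U) \<le> card S \<longrightarrow> gwins a b P (U - S) (A \<union> S) Enforcer)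
     \<Longrightarrow> gwins a b P U A Avoider"
| enforcer_move: "U \<noteq> {} \<Longrightarrow> S \<subseteq> U \<Longrightarrow> S \<noteq> {} \<Longrightarrow> min b (card U) \<le> card S
     \<Longrightarrow> gwins a b P (U - S) A Avoider \<Longrightarrow> gwins a b P U A Enforcer"

lemma enf_wins_eq_gwins:
  "enf_wins a b VH EH E U A t = gwins a b (\<lambda>X. contains_copy VH EH X (induced_edges E X)) U A t"
proof
  show "enf_wins a b VH EH E U A t \<Longrightarrow> gwins a b (\<lambda>X. contains_copy VH EH X (induced_edges E X)) U A t"
  proof (induction rule: enf_wins.induct)
    case (avoider_move U A)
    then show ?case by (intro gwins.avoider_move) auto
  qed (auto intro: gwins.intros)
  show "gwins a b (\<lambda>X. contains_copy VH EH X (induced_edges E X)) U A t \<Longrightarrow> enf_wins a b VH EH E U A t"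
  proof (induction rule: gwins.induct)
    case (avoider_move U A)
    then show ?case by (intro enf_wins.avoider_move) auto
  qed (auto intro: enf_wins.intros)
qed

lemma gwins_empty: "gwins a b P {} A t \<longleftrightarrow> P A"
  by (auto elim: gwins.cases intro: gwins.final)

lemma gwins_avoiderD:
  assumes "gwins a b P U A Avoider" "S \<subseteq> U" "S \<noteq> {}" "min a (card U) \<le> card S"
  shows "gwins a b P (U - S) (A \<union> S) Enforcer"
  using assms(1)
proof cases
  case final
  with assms show ?thesis by blast
next
  case avoider_move
  with assms show ?thesis by blast
qed

lemma gwins_enforcerE:
  assumes "gwins a b P U A Enforcer" "U \<noteq> {}"
  obtains S where "S \<subseteq> U" "S \<noteq> {}" "min b (card U) \<le> card S" "gwins a b P (U - S) A Avoider"
  using assms(1)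
proof cases
  case final
  with assms show ?thesis by blast
next
  case (enforcer_move S)
  with that show ?thesis by blast
qed

text \<open>The legal moves depend only on \<open>U\<close>, so Enforcer replays the same strategy.
  Changing \<open>P\<close> and \<open>A\<close> together covers both an enlarged family of winning
  sets and the removal of irrelevant vertices from Avoider's set.\<close>

lemma gwins_mono:
  assumes "gwins a b P U A t" "\<And>X. X \<subseteq> U \<Longrightarrow> P (A \<union> X) \<Longrightarrow> P' (A' \<union> X)"
  shows "gwins a b P' U A' t"
  using assms
proof (induction arbitrary: A' rule: gwins.induct)
  case (final A t)
  from final(2)[of "{}"] final(1) show ?case by (auto intro: gwins.final)
next
  case (avoider_move U A)
  show ?case
  proof (rule gwins.avoider_move[OF avoider_move(1)], intro allI impI)
    fix S assume S: "S \<subseteq> U \<and> S \<noteq> {} \<and> min a (card U) \<le> card S"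
    have "P' (A' \<union> S \<union> X)" if "X \<subseteq> U - S" "P (A \<union> S \<union> X)" for X
      using avoider_move(3)[of "S \<union> X"] that S by (auto simp: Un_assoc)
    with avoider_move(2) S show "gwins a b P' (U - S) (A' \<union> S) Enforcer" by blast
  qed
next
  case (enforcer_move U S A)
  have "gwins a b P' (U - S) A' Avoider"
    by (rule enforcer_move(6)) (use enforcer_move(7) in auto)
  with enforcer_move(1-4) show ?case by (rule gwins.enforcer_move)
qed

lemma gwins_trivial:
  assumes "finite U" "\<And>X. X \<subseteq> U \<Longrightarrow> P (A \<union> X)"
  shows "gwins a b P U A t"
  using assms
proof (induction U arbitrary: A t rule: finite_psubset_induct)
  case (psubset U A t)
  show ?case
  proof (cases "U = {}")
    case True
    with psubset(3)[of "{}"] show ?thesis by (simp add: gwins.final)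
  next
    case ne: False
    show ?thesis
    proof (cases t)
      case Avoider
      have "gwins a b P (U - S) (A \<union> S) Enforcer" if "S \<subseteq> U" "S \<noteq> {}" for S
      proof (rule psubset(2))
        show "U - S \<subset> U" using that by blast
        show "P (A \<union> S \<union> X)" if "X \<subseteq> U - S" for X
          using psubset(3)[of "S \<union> X"] that \<open>S \<subseteq> U\<close> by (auto simp: Un_assoc)
      qed
      with ne Avoider show ?thesis by (simp add: gwins.avoider_move)
    next
      case Enforcer
      have "gwins a b P (U - U) A Avoider"
        using psubset(3)[of "{}"] by (simp add: gwins.final)
      with ne Enforcer show ?thesis by (auto intro!: gwins.enforcer_move[of U U])
    qed
  qed
qed

lemma gwins_image:
  assumes "gwins a b P U A t" "inj_on \<phi> U"
    "\<And>X. X \<subseteq> U \<Longrightarrow> P (A \<union> X) \<Longrightarrow> P' (A' \<union> \<phi> ` X)"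
  shows "gwins a b P' (\<phi> ` U) A' t"
  using assms
proof (induction arbitrary: A' rule: gwins.induct)
  case (final A t)
  from final(3)[of "{}"] final(1) show ?case by (auto intro: gwins.final)
next
  case (avoider_move U A)
  show ?case
  proof (rule gwins.avoider_move, use avoider_move(1) in simp, intro allI impI)
    fix S' assume S': "S' \<subseteq> \<phi> ` U \<and> S' \<noteq> {} \<and> min a (card (\<phi> ` U)) \<le> card S'"
    then obtain S where S: "S \<subseteq> U" "S' = \<phi> ` S" by (meson subset_imageE)
    have inj: "inj_on \<phi> S" "inj_on \<phi> (U - S)"
      using avoider_move(3) S by (auto intro: inj_on_subset)
    have c: "min a (card U) \<le> card S" "S \<noteq> {}"
      using S' S inj avoider_move(3) by (auto simp: card_image)
    have "P' (A' \<union> S' \<union> \<phi> ` X)" if "X \<subseteq> U - S" "P (A \<union> S \<union> X)" for X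
      using avoider_move(4)[of "S \<union> X"] that S by (auto simp: Un_assoc image_Un)
    then have "gwins a b P' (\<phi> ` (U - S)) (A' \<union> S') Enforcer"
      using avoider_move(2) S(1) c inj by blast
    moreover have "\<phi> ` (U - S) = \<phi> ` U - S'"
      using avoider_move(3) S by (simp add: inj_on_image_set_diff)
    ultimately show "gwins a b P' (\<phi> ` U - S') (A' \<union> S') Enforcer" by simp
  qed
next
  case (enforcer_move U S A)
  have inj: "inj_on \<phi> S" "inj_on \<phi> (U - S)"
    using enforcer_move by (auto intro: inj_on_subset)
  have "gwins a b P' (\<phi> ` (U - S)) A' Avoider"
    by (rule enforcer_move(6)) (use enforcer_move(8) inj in auto)
  moreover have "\<phi> ` (U - S) = \<phi> ` U - \<phi> ` S"
    using enforcer_move by (simp add: inj_on_image_set_diff)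
  ultimately show ?case
    using enforcer_move inj by (intro gwins.enforcer_move[of "\<phi> ` U" "\<phi> ` S"]) (auto simp: card_image)
qed

text \<open>Below, \<open>F\<close> consists of vertices that are irrelevant for the winning condition.  Whoever is to move
  loses nothing by taking all of them, which makes the outcome independent of \<open>card F\<close>.\<close>

lemma gwins_avoider_remove_free:
  assumes fin: "finite U" "finite F" and disj: "U \<inter> F = {}"
    and free: "\<And>X Y. Y \<subseteq> F \<Longrightarrow> P (X \<union> Y) \<longleftrightarrow> P X"
    and win: "gwins a b P (U \<union> F) A Avoider"
  shows "gwins a b P U A Avoider"
proof (cases "U = {}")
  case True
  show ?thesis
  proof (cases "F = {}")
    case False
    have "gwins a b P (F - F) (A \<union> F) Enforcer"
      by (rule gwins_avoiderD) (use win True False in auto)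
    then show ?thesis using True free[of F A] by (simp add: gwins_empty)
  qed (use win in simp)
next
  case False
  show ?thesis
  proof (rule gwins.avoider_move[OF False], intro allI impI)
    fix S assume S: "S \<subseteq> U \<and> S \<noteq> {} \<and> min a (card U) \<le> card S"
    have "card (S \<union> F) = card S + card F" "card (U \<union> F) = card U + card F"
      using S fin disj by (auto intro!: card_Un_disjoint intro: finite_subset)
    then have "gwins a b P (U \<union> F - (S \<union> F)) (A \<union> (S \<union> F)) Enforcer"
      by (intro gwins_avoiderD[OF win]) (use S in auto)
    moreover have "U \<union> F - (S \<union> F) = U - S" using disj by blast
    ultimately have "gwins a b P (U - S) (A \<union> (S \<union> F)) Enforcer" by simp
    then show "gwins a b P (U - S) (A \<union> S) Enforcer"
    proof (rule gwins_mono)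
      fix X assume "P (A \<union> (S \<union> F) \<union> X)"
      then show "P (A \<union> S \<union> X)" using free[of F "A \<union> S \<union> X"] by (simp add: Un_ac)
    qed
  qed
qed

text \<open>Enforcer adds \<open>F\<close> to his winning move; board and move grow by the same
  amount, so the size bound is preserved.\<close>

lemma gwins_enforcer_add_free:
  assumes fin: "finite U" "finite F" and disj: "U \<inter> F = {}"
    and free: "\<And>X Y. Y \<subseteq> F \<Longrightarrow> P (X \<union> Y) \<longleftrightarrow> P X"
    and win: "gwins a b P U A Enforcer"
  shows "gwins a b P (U \<union> F) A Enforcer"
proof (cases "U = {}")
  case True
  then have "P A" using win by (simp add: gwins_empty)
  then show ?thesis
    using True fin free by (intro gwins_trivial) auto
next
  case False
  with win obtain S where S: "S \<subseteq> U" "S \<noteq> {}" "min b (card U) \<le> card S" "gwins a b P (U - S) A Avoider"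
    by (rule gwins_enforcerE)
  have "card (S \<union> F) = card S + card F" "card (U \<union> F) = card U + card F"
    using S fin disj by (auto intro!: card_Un_disjoint intro: finite_subset)
  moreover have "U \<union> F - (S \<union> F) = U - S" using disj by blast
  ultimately show ?thesis
    using S by (intro gwins.enforcer_move[of "U \<union> F" "S \<union> F"]) auto
qed

text \<open>The minimum size of the move is met by \<open>F\<close> alone, so the choice inside
  \<open>U\<close> becomes unrestricted and may even be empty. Conversely, irrelevant vertices that
  Enforcer leaves behind can only benefit Avoider, who is next to move.\<close>

lemma gwins_enforcer_free_iff:
  assumes fin: "finite U" "finite F" and disj: "U \<inter> F = {}"
    and free: "\<And>X Y. Y \<subseteq> F \<Longrightarrow> P (X \<union> Y) \<longleftrightarrow> P X"
    and F: "F \<noteq> {}" "b \<le> card F"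
  shows "gwins a b P (U \<union> F) A Enforcer \<longleftrightarrow> (\<exists>S\<subseteq>U. gwins a b P (U - S) A Avoider)"
proof
  assume "gwins a b P (U \<union> F) A Enforcer"
  then obtain T where T: "T \<subseteq> U \<union> F" "gwins a b P (U \<union> F - T) A Avoider"
    using F by (elim gwins_enforcerE) auto
  have "U \<union> F - T = (U - T) \<union> (F - T)" by blast
  then have "gwins a b P (U - T) A Avoider"
    by (intro gwins_avoider_remove_free[of "U - T" "F - T"])
      (use T fin disj in \<open>auto intro!: free\<close>)
  moreover have "U - T = U - (U \<inter> T)" by blast
  ultimately show "\<exists>S\<subseteq>U. gwins a b P (U - S) A Avoider" by (metis inf_le1)
next
  assume "\<exists>S\<subseteq>U. gwins a b P (U - S) A Avoider"
  then obtain S where S: "S \<subseteq> U" "gwins a b P (U - S) A Avoider" by blast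
  have "card F \<le> card (S \<union> F)"
    using S fin by (intro card_mono) (auto intro: finite_subset)
  moreover have "U \<union> F - (S \<union> F) = U - S" using disj by blast
  ultimately show "gwins a b P (U \<union> F) A Enforcer"
    using S F by (intro gwins.enforcer_move[of "U \<union> F" "S \<union> F"]) auto
qed

text \<open>Dual to the previous lemma: irrelevant vertices that Avoider leaves behind only help
  Enforcer, so it suffices to consider moves that contain all of \<open>F\<close>.\<close>

lemma gwins_avoider_free_iff:
  assumes fin: "finite U" "finite F" and disj: "U \<inter> F = {}"
    and free: "\<And>X Y. Y \<subseteq> F \<Longrightarrow> P (X \<union> Y) \<longleftrightarrow> P X"
    and F: "F \<noteq> {}" "a \<le> card F"
  shows "gwins a b P (U \<union> F) A Avoider \<longleftrightarrow> (\<forall>S\<subseteq>U. gwins a b P (U - S) (A \<union> S) Enforcer)"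
proof
  assume win: "gwins a b P (U \<union> F) A Avoider"
  show "\<forall>S\<subseteq>U. gwins a b P (U - S) (A \<union> S) Enforcer"
  proof (intro allI impI)
    fix S assume S: "S \<subseteq> U"
    have "card F \<le> card (S \<union> F)"
      using S fin by (intro card_mono) (auto intro: finite_subset)
    then have "gwins a b P (U \<union> F - (S \<union> F)) (A \<union> (S \<union> F)) Enforcer"
      by (intro gwins_avoiderD[OF win]) (use S F in auto)
    moreover have "U \<union> F - (S \<union> F) = U - S" using disj by blast
    ultimately have "gwins a b P (U - S) (A \<union> (S \<union> F)) Enforcer" by simp
    then show "gwins a b P (U - S) (A \<union> S) Enforcer"
    proof (rule gwins_mono)
      fix X assume "P (A \<union> (S \<union> F) \<union> X)"
      then show "P (A \<union> S \<union> X)" using free[of F "A \<union> S \<union> X"] by (simp add: Un_ac)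
    qed
  qed
next
  assume win: "\<forall>S\<subseteq>U. gwins a b P (U - S) (A \<union> S) Enforcer"
  show "gwins a b P (U \<union> F) A Avoider"
  proof (rule gwins.avoider_move, use F in blast, intro allI impI)
    fix T assume "T \<subseteq> U \<union> F \<and> T \<noteq> {} \<and> min a (card (U \<union> F)) \<le> card T"
    then have T: "T \<subseteq> U \<union> F" by blast
    have "gwins a b P (U - U \<inter> T) (A \<union> U \<inter> T) Enforcer" using win by blast
    then have "gwins a b P ((U - U \<inter> T) \<union> (F - T)) (A \<union> U \<inter> T) Enforcer"
      by (intro gwins_enforcer_add_free) (use fin disj in \<open>auto intro!: free\<close>)
    moreover have "(U - U \<inter> T) \<union> (F - T) = U \<union> F - T" by blast
    ultimately have "gwins a b P (U \<union> F - T) (A \<union> U \<inter> T) Enforcer" by simp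
    then show "gwins a b P (U \<union> F - T) (A \<union> T) Enforcer"
    proof (rule gwins_mono)
      fix X assume P: "P (A \<union> U \<inter> T \<union> X)"
      have "A \<union> T \<union> X = A \<union> U \<inter> T \<union> X \<union> F \<inter> T" using T by blast
      then show "P (A \<union> T \<union> X)" using free[of "F \<inter> T" "A \<union> U \<inter> T \<union> X"] P by simp
    qed
  qed
qed

section \<open>Disjoint winning sets\<close>

text \<open>Enforcer claims all that is left of \<open>b\<close> boxes. None of them has been
  completed by Avoider and they are disjoint, so this is at least \<open>b\<close> vertices and
  hence a legal move.\<close>

lemma gwins_enforcer_destroys_boxes:
  assumes "finite I" "disjoint_family_on R I" "\<And>i. i \<in> I \<Longrightarrow> finite (R i)"
    and "\<And>i. i \<in> I \<Longrightarrow> \<not> R i \<subseteq> A"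
    and J: "J \<subseteq> I" "card J = b" "b \<ge> 1"
    and win: "gwins a b P ((\<Union>i\<in>I - J. R i) - A) A Avoider"
  shows "gwins a b P ((\<Union>i\<in>I. R i) - A) A Enforcer"
proof -
  define S where "S = (\<Union>i\<in>J. R i - A)"
  have finJ: "finite J" using J assms(1) finite_subset by blast
  have "card S = (\<Sum>i\<in>J. card (R i - A))"
    unfolding S_def
  proof (rule card_UN_disjoint[OF finJ])
    show "\<forall>i\<in>J. finite (R i - A)" using assms(3) J by blast
    show "\<forall>i\<in>J. \<forall>j\<in>J. i \<noteq> j \<longrightarrow> (R i - A) \<inter> (R j - A) = {}"
      using assms(2) J unfolding disjoint_family_on_def by blast
  qed
  also have "\<dots> \<ge> (\<Sum>i\<in>J. 1)"
  proof (rule sum_mono)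
    fix i assume "i \<in> J"
    then have "R i - A \<noteq> {}" "finite (R i - A)" using assms by auto
    then show "1 \<le> card (R i - A)" by (metis Suc_leI card_gt_0_iff One_nat_def)
  qed
  finally have c: "b \<le> card S" using J by simp
  have "((\<Union>i\<in>I. R i) - A) - S = (\<Union>i\<in>I - J. R i) - A"
  proof (intro equalityI subsetI)
    fix x assume "x \<in> (\<Union>i\<in>I - J. R i) - A"
    then obtain i where i: "i \<in> I" "i \<notin> J" "x \<in> R i" "x \<notin> A" by blast
    have "x \<notin> R j" if "j \<in> J" for j
      using disjoint_family_onD[OF assms(2), of i j] i J that by blast
    with i show "x \<in> ((\<Union>i\<in>I. R i) - A) - S" by (auto simp: S_def)
  qed (auto simp: S_def)
  moreover have "S \<subseteq> (\<Union>i\<in>I. R i) - A" using J by (auto simp: S_def)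
  moreover have "S \<noteq> {}" using c J by auto
  ultimately show ?thesis
    using c win by (intro gwins.enforcer_move[of _ S]) (simp_all, blast)
qed

text \<open>The potential counts a box with \<open>r\<close> unclaimed vertices as \<open>1\<close> if \<open>r = k\<close> and as
  \<open>(b + 1) * (k - r)\<close> otherwise: a move of Avoider raises it by at least \<open>b\<close>, which pays for
  the \<open>b\<close> full boxes that Enforcer then destroys.\<close>
lemma enforcer_wins_many_boxes:
  fixes b :: nat
  assumes b: "b \<ge> 1"
  shows "\<exists>N. \<forall>(I :: 'i set) (R :: 'i \<Rightarrow> 'a set) P A.
     finite I \<and> disjoint_family_on R I \<and> (\<forall>i\<in>I. finite (R i) \<and> card (R i - A) \<le> k \<and> (\<forall>X. R i \<subseteq> X \<longrightarrow> P X))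
     \<and> N \<le> card I \<longrightarrow> gwins a b P ((\<Union>i\<in>I. R i) - A) A Avoider"
proof (induction k)
  case 0
  show ?case
  proof (intro exI[of _ 1] allI impI, elim conjE)
    fix I :: "'i set" and R :: "'i \<Rightarrow> 'a set" and P A
    assume *: "finite I" "\<forall>i\<in>I. finite (R i) \<and> card (R i - A) \<le> 0 \<and> (\<forall>X. R i \<subseteq> X \<longrightarrow> P X)" "1 \<le> card I"
    then obtain i where "i \<in> I" by fastforce
    then have "R i \<subseteq> A" using * by fastforce
    with * \<open>i \<in> I\<close> have "P (A \<union> X)" for X by blast
    with * show "gwins a b P ((\<Union>i\<in>I. R i) - A) A Avoider" by (intro gwins_trivial) auto
  qed
next
  case (Suc k')
  define k where "k = Suc k'"
  from Suc obtain N where "\<forall>(I :: 'i set) (R :: 'i \<Rightarrow> 'a set) P A.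
     finite I \<and> disjoint_family_on R I \<and> (\<forall>i\<in>I. finite (R i) \<and> card (R i - A) \<le> k' \<and> (\<forall>X. R i \<subseteq> X \<longrightarrow> P X))
     \<and> N \<le> card I \<longrightarrow> gwins a b P ((\<Union>i\<in>I. R i) - A) A Avoider" ..
  note N = this[rule_format, OF conjI, OF _ conjI, OF _ _ conjI]
  \<comment> \<open>A box missing fewer than \<open>k\<close> vertices... has value at most
    \<open>(b + 1) * k\<close>. If fewer than \<open>b\<close> boxes miss exactly \<open>k\<close>
    vertices, potential \<open>K + b\<close> thus forces \<open>N + b\<close> boxes of the first
    kind; Enforcer's move spoils at most \<open>b\<close> of them, and \<open>N\<close> are left for
    the induction hypothesis.\<close>
  define K where "K = (b + 1) * k * (N + b)"
  define q where "q r = (if r = k then 1 else (b + 1) * (k - r))" for r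
  have K: "K \<ge> 1" using b by (simp add: K_def k_def)
  have q1: "q r \<ge> 1" if "r \<le> k" for r using that by (auto simp: q_def)
  have qm: "q r \<le> q r'" if "r' \<le> r" "r \<le> k" for r r'
    using that q1[of r'] diff_le_mono2[of r' r k] by (auto simp: q_def intro!: mult_le_mono simp del: mult_Suc)
  \<comment> \<open>The factor \<open>b + 1\<close> is dictated by the first vertex that Avoider
    takes in a box with \<open>r = k\<close>: its value has to rise from \<open>1\<close> to at
    least \<open>1 + b\<close>.\<close>
  have qs: "q r + b \<le> q r'" if "r' < r" "r \<le> k" for r r'
  proof -
    have "(b + 1) * (k - r) + (b + 1) * 1 \<le> (b + 1) * (k - r')"
      unfolding distrib_left[symmetric] by (rule mult_left_mono) (use that in auto)
    with that show ?thesis by (auto simp: q_def)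
  qed
  \<comment> \<open>The invariant before every move of Avoider is potential at least
    \<open>K\<close>; the recursion is on the number of unclaimed vertices.\<close>
  have inner: "gwins a b P ((\<Union>i\<in>I. R i) - A) A Avoider"
    if "finite I" "disjoint_family_on R I" "\<forall>i\<in>I. finite (R i) \<and> card (R i - A) \<le> k \<and> (\<forall>X. R i \<subseteq> X \<longrightarrow> P X)"
      "K \<le> (\<Sum>i\<in>I. q (card (R i - A)))" for I :: "'i set" and R :: "'i \<Rightarrow> 'a set" and P A
    using that
  proof (induction "card ((\<Union>i\<in>I. R i) - A)" arbitrary: I A rule: less_induct)
    case less
    note IH = less(1) and finI = less(2) and disj = less(3) and box = less(4) and pot = less(5)
    have triv: "gwins a b P ((\<Union>i\<in>I. R i) - B) B t" if "i \<in> I" "R i \<subseteq> B" for i B t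
    proof (rule gwins_trivial)
      show "finite ((\<Union>i\<in>I. R i) - B)" using finI box by auto
      show "P (B \<union> X)" for X using box that by (meson le_supI1)
    qed
    show ?case
    proof (cases "\<exists>i\<in>I. R i \<subseteq> A")
      case True
      with triv show ?thesis by blast
    next
      case notA: False
      have "I \<noteq> {}" using pot K by auto
      with notA have Une: "(\<Union>i\<in>I. R i) - A \<noteq> {}" by blast
      show ?thesis
      proof (rule gwins.avoider_move[OF Une], intro allI impI)
        fix S assume S: "S \<subseteq> (\<Union>i\<in>I. R i) - A \<and> S \<noteq> {} \<and> min a (card ((\<Union>i\<in>I. R i) - A)) \<le> card S"
        define A' where "A' = A \<union> S"
        have US: "(\<Union>i\<in>I. R i) - A - S = (\<Union>i\<in>I. R i) - A'" by (auto simp: A'_def)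
        have "gwins a b P ((\<Union>i\<in>I. R i) - A') A' Enforcer"
        proof (cases "\<exists>i\<in>I. R i \<subseteq> A'")
          case True
          with triv show ?thesis by blast
        next
          case notA': False
          have le: "card (R i - A') \<le> card (R i - A)" if "i \<in> I" for i
            using box that by (intro card_mono) (auto simp: A'_def)
          have lek: "card (R i - A') \<le> k" if "i \<in> I" for i
            using le[OF that] box that by fastforce
          from S obtain i0 x where i0: "i0 \<in> I" "x \<in> S" "x \<in> R i0" "x \<notin> A" by blast
          have lt: "card (R i0 - A') < card (R i0 - A)"
            using box i0 by (intro psubset_card_mono) (auto simp: A'_def)
          have "K + b \<le> (\<Sum>i\<in>I. q (card (R i - A))) + b" using pot by simp
          also have "\<dots> = (q (card (R i0 - A)) + b) + (\<Sum>i\<in>I - {i0}. q (card (R i - A)))"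
            using finI i0 by (simp add: sum.remove)
          also have "\<dots> \<le> q (card (R i0 - A')) + (\<Sum>i\<in>I - {i0}. q (card (R i - A')))"
            using box i0 lt le by (intro add_mono qs sum_mono qm) auto
          also have "\<dots> = (\<Sum>i\<in>I. q (card (R i - A')))"
            using finI i0 by (simp add: sum.remove)
          finally have pot': "K + b \<le> (\<Sum>i\<in>I. q (card (R i - A')))" .
          define X where "X = {i \<in> I. card (R i - A') = k}"
          have X: "X \<subseteq> I" "finite X" using finI by (auto simp: X_def)
          \<comment> \<open>If \<open>b\<close> boxes still miss \<open>k\<close> vertices,
            destroying them costs exactly \<open>b\<close> and restores the invariant. Otherwise all
            such boxes are destroyed together with some others, and every remaining box misses at
            most \<open>k'\<close> vertices.\<close>
          obtain J where J: "J \<subseteq> I" "card J = b" "gwins a b P ((\<Union>i\<in>I - J. R i) - A') A' Avoider"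
          proof (cases "b \<le> card X")
            case True
            then obtain J where J: "J \<subseteq> X" "card J = b" by (meson obtain_subset_with_card_n)
            have JI: "J \<subseteq> I" using J X by blast
            have "(\<Sum>i\<in>I. q (card (R i - A'))) = (\<Sum>i\<in>I - J. q (card (R i - A'))) + (\<Sum>i\<in>J. q (card (R i - A')))"
              using JI finI by (simp add: sum.subset_diff)
            also have "(\<Sum>i\<in>J. q (card (R i - A'))) = (\<Sum>i\<in>J. 1)"
              using J by (intro sum.cong) (auto simp: X_def q_def)
            finally have "K \<le> (\<Sum>i\<in>I - J. q (card (R i - A')))" using pot' J by simp
            moreover have "card ((\<Union>i\<in>I - J. R i) - A') < card ((\<Union>i\<in>I. R i) - A)"
              using finI box S by (intro psubset_card_mono) (auto simp: A'_def)
            moreover have "disjoint_family_on R (I - J)"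
              using disj by (auto simp: disjoint_family_on_def)
            ultimately have "gwins a b P ((\<Union>i\<in>I - J. R i) - A') A' Avoider"
              using finI box lek by (intro IH) auto
            with J JI that show ?thesis by blast
          next
            case False
            have "(\<Sum>i\<in>I. q (card (R i - A'))) = (\<Sum>i\<in>I - X. q (card (R i - A'))) + (\<Sum>i\<in>X. q (card (R i - A')))"
              using X finI by (simp add: sum.subset_diff)
            also have "(\<Sum>i\<in>X. q (card (R i - A'))) = (\<Sum>i\<in>X. 1)"
              by (intro sum.cong) (auto simp: X_def q_def)
            also have "(\<Sum>i\<in>I - X. q (card (R i - A'))) \<le> (\<Sum>i\<in>I - X. (b + 1) * k)"
              by (intro sum_mono) (auto simp: q_def X_def intro!: add_mono mult_le_mono)
            finally have "K \<le> (b + 1) * k * card (I - X)" using pot' False by (simp add: mult.commute)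
            then have cX: "N + b \<le> card (I - X)" unfolding K_def by (subst (asm) mult_le_cancel1) (simp add: k_def)
            then obtain J' where J': "J' \<subseteq> I - X" "card J' = b - card X"
              by (meson obtain_subset_with_card_n le_add2 diff_le_self order_trans)
            define J where "J = X \<union> J'"
            have finJ': "finite J'" using J' finI finite_subset by blast
            have J: "J \<subseteq> I" "card J = b"
              using J' X False card_Un_disjoint[OF X(2) finJ'] by (auto simp: J_def)
            have "card (I - J) = card (I - X - J')" by (rule arg_cong[of _ _ card]) (auto simp: J_def)
            also have "\<dots> = card (I - X) - card J'" using J' finJ' by (intro card_Diff_subset) auto
            finally have "N \<le> card (I - J)" using cX J' by simp
            moreover have "card (R i - A') \<le> k'" if "i \<in> I - J" for i
              using lek[of i] that by (auto simp: J_def X_def k_def)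
            moreover have "disjoint_family_on R (I - J)"
              using disj by (auto simp: disjoint_family_on_def)
            ultimately have "gwins a b P ((\<Union>i\<in>I - J. R i) - A') A' Avoider"
              using finI box by (intro N) (simp_all, blast)
            with J that show ?thesis by blast
          qed
          show ?thesis
            by (rule gwins_enforcer_destroys_boxes[OF finI disj _ _ J(1,2) b J(3)]) (use box notA' in auto)
        qed
        then show "gwins a b P ((\<Union>i\<in>I. R i) - A - S) (A \<union> S) Enforcer"
          unfolding US by (simp add: A'_def)
      qed
    qed
  qed
  show ?case
  proof (intro exI[of _ K] allI impI, elim conjE)
    fix I :: "'i set" and R :: "'i \<Rightarrow> 'a set" and P A
    assume *: "finite I" "disjoint_family_on R I" "\<forall>i\<in>I. finite (R i) \<and> card (R i - A) \<le> Suc k' \<and> (\<forall>X. R i \<subseteq> X \<longrightarrow> P X)" "K \<le> card I"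
    have "card I = (\<Sum>i\<in>I. 1)" by simp
    also have "\<dots> \<le> (\<Sum>i\<in>I. q (card (R i - A)))"
      using * by (intro sum_mono q1) (auto simp: k_def)
    finally show "gwins a b P ((\<Union>i\<in>I. R i) - A) A Avoider"
      using * by (intro inner) (auto simp: k_def)
  qed
qed

text \<open>The outcome of the game on \<open>M\<close> disjoint winning sets of size \<open>k\<close> and at least \<open>max a b\<close> further
  vertices: the two cases are the right-hand sides of \<open>gwins_avoider_free_iff\<close> and \<open>gwins_enforcer_free_iff\<close>.\<close>

definition box_value :: "nat \<Rightarrow> nat \<Rightarrow> player \<Rightarrow> nat \<Rightarrow> nat \<Rightarrow> bool" where
  "box_value a b t k M =
     (let U = {..<M} \<times> {..<k}; P = (\<lambda>X. \<exists>i<M. {i} \<times> {..<k} \<subseteq> X)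
      in case t of Avoider \<Rightarrow> \<forall>S\<subseteq>U. gwins a b P (U - S) S Enforcer
                 | Enforcer \<Rightarrow> \<exists>S\<subseteq>U. gwins a b P (U - S) {} Avoider)"

lemma ex_box_value:
  assumes "b \<ge> 1"
  shows "\<exists>M. box_value a b t k M"
proof -
  define R where "R i = {i} \<times> {..<k}" for i :: nat
  obtain N where "\<forall>(I :: nat set) (R :: nat \<Rightarrow> (nat \<times> nat) set) P A.
     finite I \<and> disjoint_family_on R I \<and> (\<forall>i\<in>I. finite (R i) \<and> card (R i - A) \<le> k \<and> (\<forall>X. R i \<subseteq> X \<longrightarrow> P X))
     \<and> N \<le> card I \<longrightarrow> gwins a b P ((\<Union>i\<in>I. R i) - A) A Avoider"
    using enforcer_wins_many_boxes[OF assms] by (rule exE)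
  note N = this[rule_format, OF conjI, OF _ conjI, OF _ _ conjI]
  \<comment> \<open>The additional \<open>b\<close> boxes are for Avoider as first player:
    Enforcer's reply destroys \<open>b\<close> boxes and leaves \<open>N\<close> with Avoider to
    move. As first player, Enforcer takes no box vertex at all.\<close>
  define M where "M = N + b"
  define P where "P X \<longleftrightarrow> (\<exists>i<M. R i \<subseteq> X)" for X
  have card_R: "card (R i - A) \<le> k" for i A
    using card_mono[of "R i" "R i - A"] by (simp add: R_def)
  have disj: "disjoint_family_on R I" for I
    by (auto simp: disjoint_family_on_def R_def)
  have win: "gwins a b P ((\<Union>i\<in>I. R i) - A) A Avoider" if "I \<subseteq> {..<M}" "N \<le> card I" for I A
    using that card_R by (intro N disj) (auto simp: R_def P_def intro: finite_subset)
  have U: "{..<M} \<times> {..<k} = (\<Union>i\<in>{..<M}. R i)" by (auto simp: R_def)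
  have PR: "(\<lambda>X. \<exists>i<M. {i} \<times> {..<k} \<subseteq> X) = P" by (simp add: fun_eq_iff P_def R_def)
  have "box_value a b t k M"
  proof (cases t)
    case Avoider
    have "gwins a b P ((\<Union>i\<in>{..<M}. R i) - S) S Enforcer" for S
    proof (cases "\<exists>i\<in>{..<M}. R i \<subseteq> S")
      case True
      then show ?thesis by (intro gwins_trivial) (auto simp: P_def R_def)
    next
      case False
      have "gwins a b P ((\<Union>i\<in>{..<M} - {..<b}. R i) - S) S Avoider"
        by (intro win) (auto simp: M_def card_Diff_subset)
      then show ?thesis
        using False assms
        by (intro gwins_enforcer_destroys_boxes[where J = "{..<b}"] disj) (auto simp: M_def R_def)
    qed
    then show ?thesis unfolding box_value_def Let_def Avoider PR U player.case by blast
  next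
    case Enforcer
    have "gwins a b P ((\<Union>i\<in>{..<M}. R i) - {}) {} Avoider" by (intro win) (auto simp: M_def)
    then show ?thesis unfolding box_value_def Let_def Enforcer PR U player.case by blast
  qed
  then show ?thesis ..
qed

section \<open>Transport of disjoint winning sets to a standard board\<close>

lemma gwins_image_iff:
  assumes inj: "inj_on \<phi> W" and UA: "U \<subseteq> W" "A \<subseteq> W"
    and P: "\<And>X. X \<subseteq> W \<Longrightarrow> P' (\<phi> ` X) \<longleftrightarrow> P X"
  shows "gwins a b P' (\<phi> ` U) (\<phi> ` A) t \<longleftrightarrow> gwins a b P U A t"
proof
  assume "gwins a b P U A t"
  then show "gwins a b P' (\<phi> ` U) (\<phi> ` A) t"
  proof (rule gwins_image)
    show "inj_on \<phi> U" using inj UA inj_on_subset by blast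
    show "P' (\<phi> ` A \<union> \<phi> ` X)" if "X \<subseteq> U" "P (A \<union> X)" for X
      using that UA P[of "A \<union> X"] by (simp add: image_Un)
  qed
next
  define \<psi> where "\<psi> = inv_into W \<phi>"
  have inv: "\<psi> ` (\<phi> ` X) = X" if "X \<subseteq> W" for X
    unfolding \<psi>_def using inj that by (rule inv_into_image_cancel)
  assume "gwins a b P' (\<phi> ` U) (\<phi> ` A) t"
  then have "gwins a b P (\<psi> ` (\<phi> ` U)) A t"
  proof (rule gwins_image)
    show "inj_on \<psi> (\<phi> ` U)"
      unfolding \<psi>_def using UA by (intro inj_on_inv_into) auto
    fix Y assume Y: "Y \<subseteq> \<phi> ` U" "P' (\<phi> ` A \<union> Y)"
    then obtain X where X: "X \<subseteq> U" "Y = \<phi> ` X" by (meson subset_imageE)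
    with UA have "X \<subseteq> W" by blast
    with Y X P[of "A \<union> X"] UA show "P (A \<union> \<psi> ` Y)" by (simp add: image_Un inv)
  qed
  then show "gwins a b P U A t" using inv UA by simp
qed

lemma disjoint_sets_parametrization:
  assumes "finite \<V>" "disjoint \<V>" and card: "\<And>V. V \<in> \<V> \<Longrightarrow> card V = k" and "k \<ge> 1"
  obtains \<phi> e where "inj_on \<phi> ({..<card \<V>} \<times> {..<k})" "bij_betw e {..<card \<V>} \<V>"
    "\<And>i. i < card \<V> \<Longrightarrow> \<phi> ` ({i} \<times> {..<k}) = e i"
proof -
  obtain e where e: "bij_betw e {..<card \<V>} \<V>"
    using ex_bij_betw_nat_finite[OF assms(1)] by (auto simp: atLeast0LessThan)
  have "\<exists>h. bij_betw h {..<k} V" if "V \<in> \<V>" for V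
  proof -
    have "finite V" using card[OF that] assms(4) by (intro card_ge_0_finite) simp
    then show ?thesis using ex_bij_betw_nat_finite[of V] card[OF that] by (auto simp: atLeast0LessThan)
  qed
  then obtain h where h: "\<And>V. V \<in> \<V> \<Longrightarrow> bij_betw (h V) {..<k} V" by metis
  define \<phi> where "\<phi> = (\<lambda>(i, j). h (e i) j)"
  have ei: "e i \<in> \<V>" if "i < card \<V>" for i using e that by (auto simp: bij_betw_def)
  have im: "\<phi> ` ({i} \<times> {..<k}) = e i" if "i < card \<V>" for i
  proof -
    have "\<phi> ` ({i} \<times> {..<k}) = h (e i) ` {..<k}" by (force simp: \<phi>_def)
    then show ?thesis using h[OF ei[OF that]] by (simp add: bij_betw_def)
  qed
  have "inj_on \<phi> ({..<card \<V>} \<times> {..<k})"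
  proof (rule inj_onI, clarsimp)
    fix i j i' j' assume *: "i < card \<V>" "j < k" "i' < card \<V>" "j' < k" "\<phi> (i, j) = \<phi> (i', j')"
    then have "\<phi> (i, j) \<in> e i" "\<phi> (i', j') \<in> e i'" using im by blast+
    then have "e i \<inter> e i' \<noteq> {}" using * by auto
    then have "e i = e i'" using assms(2) ei * by (meson disjointD)
    then have ii: "i = i'" using e * by (auto simp: bij_betw_def dest: inj_onD)
    with * h[OF ei, of i] show "i = i' \<and> j = j'"
      by (auto simp: \<phi>_def bij_betw_def dest: inj_onD)
  qed
  with e im show ?thesis using that by blast
qed

text \<open>The winning sets cover at most \<open>k * card \<V>\<close> vertices, so
  \<open>F\<close> has at least \<open>max a b\<close> elements and either first player can move
  legally within \<open>F\<close>. What remains after that move is a game on the boxes alone, which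
  \<phi> carries to the standard board.\<close>

lemma gwins_disjoint_sets_iff:
  fixes \<V> :: "'a set set"
  assumes fin: "finite \<V>" "finite X" and disj: "disjoint \<V>"
    and card: "\<And>V. V \<in> \<V> \<Longrightarrow> card V = k" and k: "k \<ge> 1" and sub: "\<Union>\<V> \<subseteq> X"
    and large: "k * card \<V> + max a b \<le> card X" and ab: "a \<ge> 1" "b \<ge> 1"
  shows "gwins a b (\<lambda>Y. \<exists>V\<in>\<V>. V \<subseteq> Y) X {} t \<longleftrightarrow> box_value a b t k (card \<V>)"
proof -
  define M where "M = card \<V>"
  define W where "W = {..<M} \<times> {..<k}"
  define P' where "P' Y \<longleftrightarrow> (\<exists>V\<in>\<V>. V \<subseteq> Y)" for Y
  define P where "P Y \<longleftrightarrow> (\<exists>i<M. {i} \<times> {..<k} \<subseteq> Y)" for Y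
  define F where "F = X - \<Union>\<V>"
  obtain \<phi> e where \<phi>: "inj_on \<phi> W" and e: "bij_betw e {..<M} \<V>"
    and im: "\<And>i. i < M \<Longrightarrow> \<phi> ` ({i} \<times> {..<k}) = e i"
    using disjoint_sets_parametrization[OF fin(1) disj card k] unfolding M_def W_def by blast
  have \<V>: "\<V> = e ` {..<M}" using e by (auto simp: bij_betw_def)
  have W: "W = (\<Union>i<M. {i} \<times> {..<k})" by (auto simp: W_def)
  have \<phi>W: "\<phi> ` W = \<Union>\<V>" unfolding W image_UN \<V> using im by auto
  have PP: "P' (\<phi> ` Y) \<longleftrightarrow> P Y" if "Y \<subseteq> W" for Y
  proof -
    have "e i \<subseteq> \<phi> ` Y \<longleftrightarrow> {i} \<times> {..<k} \<subseteq> Y" if "i < M" for i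
      unfolding im[OF that, symmetric]
      by (rule inj_on_image_subset_iff[OF \<phi>]) (use that \<open>Y \<subseteq> W\<close> in \<open>auto simp: W_def\<close>)
    then show ?thesis by (auto simp: P'_def P_def \<V>)
  qed
  have iff: "gwins a b P' (\<Union>\<V> - \<phi> ` S) (\<phi> ` A) t \<longleftrightarrow> gwins a b P (W - S) A t"
    if "S \<subseteq> W" "A \<subseteq> W" for S A t
  proof -
    have "\<Union>\<V> - \<phi> ` S = \<phi> ` (W - S)"
      unfolding \<phi>W[symmetric] using \<phi> that by (simp add: inj_on_image_set_diff)
    then show ?thesis using gwins_image_iff[OF \<phi>, of "W - S" A P' P] PP that by auto
  qed
  have finU: "finite (\<Union>\<V>)" using sub fin by (auto intro: finite_subset)
  have "card (\<Union>\<V>) \<le> k * card \<V>"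
    using card_Union_le_sum_card[of \<V>] card by (simp add: mult.commute)
  moreover have "card F = card X - card (\<Union>\<V>)"
    unfolding F_def using finU sub by (intro card_Diff_subset) auto
  ultimately have cF: "max a b \<le> card F" using large by linarith
  then have Fne: "F \<noteq> {}" using ab by auto
  have X: "X = \<Union>\<V> \<union> F" using sub by (auto simp: F_def)
  have free: "P' (Z \<union> Y) \<longleftrightarrow> P' Z" if "Y \<subseteq> F" for Y Z
  proof -
    have "V \<inter> Y = {}" if "V \<in> \<V>" for V using \<open>Y \<subseteq> F\<close> that by (auto simp: F_def)
    then show ?thesis unfolding P'_def by blast
  qed
  have FU: "\<Union>\<V> \<inter> F = {}" by (auto simp: F_def)
  have finF: "finite F" using fin by (auto simp: F_def)
  have sub_iff: "(\<forall>S\<subseteq>\<Union>\<V>. Q S) \<longleftrightarrow> (\<forall>S\<subseteq>W. Q (\<phi> ` S))" "(\<exists>S\<subseteq>\<Union>\<V>. Q S) \<longleftrightarrow> (\<exists>S\<subseteq>W. Q (\<phi> ` S))" for Q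
    unfolding \<phi>W[symmetric] by (auto simp: subset_image_iff)
  have "gwins a b P' X {} t \<longleftrightarrow> box_value a b t k M"
  proof (cases t)
    case Avoider
    have "gwins a b P' X {} Avoider \<longleftrightarrow> (\<forall>S\<subseteq>\<Union>\<V>. gwins a b P' (\<Union>\<V> - S) ({} \<union> S) Enforcer)"
      unfolding X using cF by (intro gwins_avoider_free_iff finU finF FU Fne free) auto
    also have "\<dots> \<longleftrightarrow> (\<forall>S\<subseteq>W. gwins a b P (W - S) S Enforcer)"
      unfolding sub_iff using iff by auto
    finally show ?thesis using Avoider
      by (simp add: box_value_def Let_def W_def P_def[abs_def])
  next
    case Enforcer
    have "gwins a b P' X {} Enforcer \<longleftrightarrow> (\<exists>S\<subseteq>\<Union>\<V>. gwins a b P' (\<Union>\<V> - S) {} Avoider)"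
      unfolding X using cF by (intro gwins_enforcer_free_iff finU finF FU Fne free) auto
    also have "\<dots> \<longleftrightarrow> (\<exists>S\<subseteq>W. gwins a b P (W - S) {} Avoider)"
      unfolding sub_iff using iff[of _ "{}"] by auto
    finally show ?thesis using Enforcer
      by (simp add: box_value_def Let_def W_def P_def[abs_def])
  qed
  then show ?thesis unfolding P'_def[abs_def] M_def .
qed

section \<open>Copies of a graph as winning sets\<close>

lemma copies_iff:
  "C \<in> copies VH EH V E \<longleftrightarrow> (\<exists>f. inj_on f VH \<and> f ` VH \<subseteq> V \<and> (\<forall>e\<in>EH. f ` e \<in> E)
      \<and> C = (f ` VH, (\<lambda>e. f ` e) ` EH))"
  by (auto simp: copies_def)

lemma finite_copies:
  assumes "finite V" "finite E"
  shows "finite (copies VH EH V E)"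
  by (rule finite_subset[of _ "Pow V \<times> Pow E"]) (use assms in \<open>auto simp: copies_def\<close>)

lemma card_fst_copies:
  "C \<in> copies VH EH V E \<Longrightarrow> card (fst C) = card VH"
  by (auto simp: copies_def card_image)

text \<open>A copy whose vertices lie in \<open>X\<close> has its edges in \<open>X\<close> as well,
  so the game sees only the vertex sets of copies.\<close>

lemma contains_copy_induced_iff:
  assumes "is_graph VH EH" "X \<subseteq> V"
  shows "contains_copy VH EH X (induced_edges E X) \<longleftrightarrow> (\<exists>W\<in>fst ` copies VH EH V E. W \<subseteq> X)"
proof
  assume "contains_copy VH EH X (induced_edges E X)"
  then obtain f where f: "inj_on f VH" "f ` VH \<subseteq> X" "\<forall>e\<in>EH. f ` e \<in> induced_edges E X"
    by (auto simp: contains_copy_def copies_def)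
  then have "(f ` VH, (\<lambda>e. f ` e) ` EH) \<in> copies VH EH V E"
    unfolding copies_iff using assms(2) by (intro exI[of _ f]) (auto simp: induced_edges_def)
  then show "\<exists>W\<in>fst ` copies VH EH V E. W \<subseteq> X" using f(2) by (metis fst_conv imageI)
next
  assume "\<exists>W\<in>fst ` copies VH EH V E. W \<subseteq> X"
  then obtain f where f: "inj_on f VH" "f ` VH \<subseteq> X" "\<forall>e\<in>EH. f ` e \<in> E"
    by (auto simp: copies_def)
  have "f ` e \<in> induced_edges E X" if "e \<in> EH" for e
    using f assms(1) that by (fastforce simp: induced_edges_def is_graph_def)
  with f have "(f ` VH, (\<lambda>e. f ` e) ` EH) \<in> copies VH EH X (induced_edges E X)"
    unfolding copies_iff by blast
  then show "contains_copy VH EH X (induced_edges E X)" by (auto simp: contains_copy_def)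
qed

lemma enforcer_wins_game_iff_gwins:
  assumes "is_graph VH EH"
  shows "enforcer_wins_game a b t VH EH n E \<longleftrightarrow>
    gwins a b (\<lambda>Y. \<exists>W\<in>fst ` copies VH EH {0..<n} E. W \<subseteq> Y) {0..<n} {} t"
  unfolding enforcer_wins_game_def enf_wins_eq_gwins
proof
  have *: "contains_copy VH EH ({} \<union> X) (induced_edges E ({} \<union> X)) \<longleftrightarrow>
      (\<exists>W\<in>fst ` copies VH EH {0..<n} E. W \<subseteq> {} \<union> X)" if "X \<subseteq> {0..<n}" for X
    unfolding Un_empty_left by (rule contains_copy_induced_iff[OF assms that])
  show "gwins a b (\<lambda>X. contains_copy VH EH X (induced_edges E X)) {0..<n} {} t \<Longrightarrow>
      gwins a b (\<lambda>Y. \<exists>W\<in>fst ` copies VH EH {0..<n} E. W \<subseteq> Y) {0..<n} {} t"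
    by (erule gwins_mono) (simp only: *)
  show "gwins a b (\<lambda>Y. \<exists>W\<in>fst ` copies VH EH {0..<n} E. W \<subseteq> Y) {0..<n} {} t \<Longrightarrow>
      gwins a b (\<lambda>X. contains_copy VH EH X (induced_edges E X)) {0..<n} {} t"
    by (erule gwins_mono) (simp only: *)
qed

text \<open>Copies outside \<open>\<V>\<close> may intersect anything: more winning sets only help
  Enforcer, so he plays as if \<open>\<V>\<close> were the whole family.\<close>

lemma enforcer_wins_disjoint_copies:
  assumes H: "is_graph VH EH" "VH \<noteq> {}" and ab: "a \<ge> 1" "b \<ge> 1"
    and \<V>: "\<V> \<subseteq> fst ` copies VH EH {0..<n} E" "disjoint \<V>" "card \<V> = N" "finite \<V>"
    and N: "box_value a b t (card VH) N" and n: "card VH * N + max a b \<le> n"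
  shows "enforcer_wins_game a b t VH EH n E"
proof -
  have k: "card VH \<ge> 1" using H by (auto simp: is_graph_def Suc_le_eq card_gt_0_iff)
  have "gwins a b (\<lambda>Y. \<exists>W\<in>\<V>. W \<subseteq> Y) {0..<n} {} t \<longleftrightarrow> box_value a b t (card VH) (card \<V>)"
  proof (rule gwins_disjoint_sets_iff)
    show "card V = card VH" if "V \<in> \<V>" for V using \<V>(1) that card_fst_copies by fastforce
    show "\<Union>\<V> \<subseteq> {0..<n}" using \<V>(1) by (fastforce simp: copies_def)
  qed (use \<V> k n ab in auto)
  then have "gwins a b (\<lambda>Y. \<exists>W\<in>\<V>. W \<subseteq> Y) {0..<n} {} t" using \<V> N by simp
  then show ?thesis
    unfolding enforcer_wins_game_iff_gwins[OF H(1)] by (rule gwins_mono) (use \<V>(1) in \<open>meson subsetD\<close>)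
qed

text \<open>\<open>contains_N_copies\<close> counts pairs of a vertex set and an edge set, while the
  game knows only vertex sets. Disjointness of distinct copies reconciles the two counts, since two
  copies on the same nonempty vertex set would meet.\<close>

lemma inj_on_fst_disjoint_copies:
  assumes "VH \<noteq> {}"
    and disj: "\<And>C D. C \<in> copies VH EH V E \<Longrightarrow> D \<in> copies VH EH V E \<Longrightarrow> C \<noteq> D \<Longrightarrow> fst C \<inter> fst D = {}"
  shows "inj_on fst (copies VH EH V E)"
proof (rule inj_onI, rule ccontr)
  fix C D assume *: "C \<in> copies VH EH V E" "D \<in> copies VH EH V E" "fst C = fst D" "C \<noteq> D"
  have "fst C \<noteq> {}" using * assms(1) by (auto simp: copies_def)
  with disj[of C D] * show False by auto
qed

lemma enforcer_wins_iff_box_value: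
  assumes H: "is_graph VH EH" "VH \<noteq> {}" and ab: "a \<ge> 1" "b \<ge> 1" and E: "finite E"
    and disj: "\<And>C D. C \<in> copies VH EH {0..<n} E \<Longrightarrow> D \<in> copies VH EH {0..<n} E \<Longrightarrow> C \<noteq> D \<Longrightarrow> fst C \<inter> fst D = {}"
    and n: "card VH * card (copies VH EH {0..<n} E) + max a b \<le> n"
  shows "enforcer_wins_game a b t VH EH n E \<longleftrightarrow> box_value a b t (card VH) (card (copies VH EH {0..<n} E))"
proof -
  let ?C = "copies VH EH {0..<n} E"
  have k: "card VH \<ge> 1" using H by (auto simp: is_graph_def Suc_le_eq card_gt_0_iff)
  have inj: "inj_on fst ?C" using H(2) disj by (rule inj_on_fst_disjoint_copies)
  have "gwins a b (\<lambda>Y. \<exists>W\<in>fst ` ?C. W \<subseteq> Y) {0..<n} {} t \<longleftrightarrow> box_value a b t (card VH) (card (fst ` ?C))"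
  proof (rule gwins_disjoint_sets_iff)
    show "card V = card VH" if "V \<in> fst ` ?C" for V using that card_fst_copies by fastforce
    show "\<Union>(fst ` ?C) \<subseteq> {0..<n}" by (fastforce simp: copies_def)
    show "disjoint (fst ` ?C)"
    proof (rule disjointI)
      fix V W assume "V \<in> fst ` ?C" "W \<in> fst ` ?C" "V \<noteq> W"
      then obtain C D where "C \<in> ?C" "D \<in> ?C" "C \<noteq> D" "V = fst C" "W = fst D" by blast
      then show "V \<inter> W = {}" using disj by blast
    qed
  qed (use k n ab inj finite_copies[of "{0..<n}" E] E in \<open>auto simp: card_image\<close>)
  then show "enforcer_wins_game a b t VH EH n E \<longleftrightarrow> box_value a b t (card VH) (card ?C)"
    unfolding enforcer_wins_game_iff_gwins[OF H(1)] using inj by (simp add: card_image)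
qed

text \<open>This bypasses the question whether \<open>box_value\<close> is monotone in the number of
  boxes: with more than \<open>N\<close> copies Enforcer concentrates on \<open>N\<close> of them,
  and with fewer the minimality of \<open>N\<close> decides. It also explains why \<open>n\<close>
  has to be large only in terms of \<open>N\<close>.\<close>

lemma enforcer_wins_iff_contains_least_copies:
  assumes H: "is_graph VH EH" "VH \<noteq> {}" and ab: "a \<ge> 1" "b \<ge> 1" and E: "finite E"
    and disj: "\<And>C D. C \<in> copies VH EH {0..<n} E \<Longrightarrow> D \<in> copies VH EH {0..<n} E \<Longrightarrow> C \<noteq> D \<Longrightarrow> fst C \<inter> fst D = {}"
    and N: "N = (LEAST M. box_value a b t (card VH) M)" and n: "card VH * N + max a b \<le> n"
  shows "enforcer_wins_game a b t VH EH n E \<longleftrightarrow> contains_N_copies N VH EH {0..<n} E"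
proof (cases "N \<le> card (copies VH EH {0..<n} E)")
  case True
  let ?C = "copies VH EH {0..<n} E"
  have inj: "inj_on fst ?C" using H(2) disj by (rule inj_on_fst_disjoint_copies)
  obtain \<C> where \<C>: "\<C> \<subseteq> ?C" "card \<C> = N" using True by (meson obtain_subset_with_card_n)
  have inj': "inj_on fst \<C>" using inj \<C> inj_on_subset by blast
  have "enforcer_wins_game a b t VH EH n E"
  proof (rule enforcer_wins_disjoint_copies[OF H ab, of "fst ` \<C>" n E N])
    show "disjoint (fst ` \<C>)"
    proof (rule disjointI)
      fix V W assume "V \<in> fst ` \<C>" "W \<in> fst ` \<C>" "V \<noteq> W"
      then obtain C D where "C \<in> ?C" "D \<in> ?C" "C \<noteq> D" "V = fst C" "W = fst D" using \<C> by blast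
      then show "V \<inter> W = {}" using disj by blast
    qed
    show "card (fst ` \<C>) = N" using inj' \<C> by (simp add: card_image)
    show "finite (fst ` \<C>)" using \<C> finite_copies[of "{0..<n}" E] E by (meson finite_atLeastLessThan finite_imageI finite_subset)
    show "box_value a b t (card VH) N"
      unfolding N using ex_box_value[OF ab(2)] by (rule LeastI_ex)
  qed (use \<C> n in auto)
  then show ?thesis using True by (simp add: contains_N_copies_def)
next
  case False
  then have "\<not> box_value a b t (card VH) (card (copies VH EH {0..<n} E))"
    unfolding N by (meson not_less_Least not_le)
  moreover have "card VH * card (copies VH EH {0..<n} E) + max a b \<le> n"
    using False by (intro order_trans[OF add_right_mono n] mult_le_mono2) simp
  then have "enforcer_wins_game a b t VH EH n E \<longleftrightarrow>
      box_value a b t (card VH) (card (copies VH EH {0..<n} E))"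
    by (intro enforcer_wins_iff_box_value[OF H ab E disj])
  ultimately show ?thesis using False by (simp add: contains_N_copies_def)
qed

section \<open>Overlapping embeddings\<close>

text \<open>Labelled copies, so that no automorphisms have to be counted; they are extensional
  outside \<open>V\<close> so that there are finitely many.\<close>

definition embeddings :: "'h set \<Rightarrow> nat \<Rightarrow> ('h \<Rightarrow> nat) set" where
  "embeddings V n = {g \<in> V \<rightarrow>\<^sub>E {0..<n}. inj_on g V}"

definition edge_image :: "('h \<Rightarrow> 'a) \<Rightarrow> 'h set set \<Rightarrow> 'a set set" where
  "edge_image g E = (\<lambda>e. g ` e) ` E"

text \<open>The intersection type of a pair of embeddings: for injective \<open>g\<close> and
  \<open>h\<close> it is a partial injection on \<open>V\<close>. As a subset of
  \<open>V \<times> V\<close> it takes at most \<open>2 ^ (card V * card V)\<close> values, which is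
  the source of this constant in the moment bounds.\<close>

definition overlap :: "'h set \<Rightarrow> ('h \<Rightarrow> 'a) \<Rightarrow> ('h \<Rightarrow> 'a) \<Rightarrow> ('h \<times> 'h) set" where
  "overlap V g h = {(u, v) \<in> V \<times> V. g u = h v}"

lemma finite_pairs: "finite (pairs n)"
  by (rule finite_subset[of _ "Pow {0..<n}"]) (auto simp: pairs_def)

lemma card_pairs: "card (pairs n) = n choose 2"
  using n_subsets[of "{0..<n}" 2] by (simp add: pairs_def)

lemma finite_edges: "is_graph V E \<Longrightarrow> finite E"
  by (rule finite_subset[of _ "Pow V"]) (auto simp: is_graph_def)

lemma finite_embeddings: "finite V \<Longrightarrow> finite (embeddings V n)"
  unfolding embeddings_def by (rule finite_subset[OF _ finite_PiE[of V "\<lambda>_. {0..<n}"]]) auto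

lemma card_embeddings_le:
  assumes "finite V"
  shows "card (embeddings V n) \<le> n ^ card V"
proof -
  have "card (embeddings V n) \<le> card (V \<rightarrow>\<^sub>E {0..<n})"
    using assms by (intro card_mono finite_PiE) (auto simp: embeddings_def)
  then show ?thesis using assms by (simp add: card_funcsetE)
qed

lemma card_embeddings_ge:
  assumes "finite V" "2 * card V \<le> n"
  shows "(real n / 2) ^ card V \<le> real (card (embeddings V n))"
proof -
  have "(real n / 2) ^ card V = (\<Prod>i\<in>{0..<card V}. real n / 2)" by simp
  also have "\<dots> \<le> (\<Prod>i\<in>{0..<card V}. real (n - i))"
    using assms by (intro prod_mono) auto
  also have "\<dots> = real (card (embeddings V n))"
    using card_inj_on_subset_funcset[of V "{0..<n}" V] assms by (simp add: embeddings_def)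
  finally show ?thesis .
qed

lemma inj_on_image_edges:
  assumes "is_graph V E" "inj_on g V"
  shows "inj_on (\<lambda>e. g ` e) E"
  by (rule inj_on_subset[OF inj_on_image_Pow[OF assms(2)]]) (use assms(1) in \<open>auto simp: is_graph_def\<close>)

lemma card_edge_image:
  assumes "is_graph V E" "inj_on g V"
  shows "card (edge_image g E) = card E"
  unfolding edge_image_def by (rule card_image[OF inj_on_image_edges[OF assms]])

lemma edge_image_subset_pairs:
  assumes "is_graph V E" "g \<in> embeddings V n"
  shows "edge_image g E \<subseteq> pairs n"
proof
  fix x assume "x \<in> edge_image g E"
  then obtain e where e: "e \<in> E" "x = g ` e" by (auto simp: edge_image_def)
  have "e \<subseteq> V" "card e = 2" using assms e by (auto simp: is_graph_def)
  moreover have "inj_on g e" using assms(2) \<open>e \<subseteq> V\<close> by (auto simp: embeddings_def intro: inj_on_subset)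
  ultimately show "x \<in> pairs n"
    using assms(2) e by (auto simp: pairs_def card_image embeddings_def)
qed

lemma copies_eq_embeddings:
  assumes "is_graph V E"
  shows "copies V E {0..<n} G = (\<lambda>g. (g ` V, edge_image g E)) ` {g \<in> embeddings V n. edge_image g E \<subseteq> G}"
proof (intro equalityI subsetI)
  fix C assume "C \<in> copies V E {0..<n} G"
  then obtain f where f: "inj_on f V" "f ` V \<subseteq> {0..<n}" "\<forall>e\<in>E. f ` e \<in> G" "C = (f ` V, edge_image f E)"
    by (auto simp: copies_def edge_image_def)
  define g where "g = restrict f V"
  have im: "g ` e = f ` e" if "e \<subseteq> V" for e
    using that unfolding g_def by (intro image_cong) auto
  have "edge_image g E = edge_image f E"
    unfolding edge_image_def by (rule image_cong) (use im assms in \<open>auto simp: is_graph_def\<close>)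
  moreover have "g \<in> embeddings V n"
    using f by (auto simp: embeddings_def g_def inj_on_def)
  ultimately show "C \<in> (\<lambda>g. (g ` V, edge_image g E)) ` {g \<in> embeddings V n. edge_image g E \<subseteq> G}"
    using f im[of V] by (intro image_eqI[of _ _ g]) (auto simp: edge_image_def)
next
  fix C assume "C \<in> (\<lambda>g. (g ` V, edge_image g E)) ` {g \<in> embeddings V n. edge_image g E \<subseteq> G}"
  then show "C \<in> copies V E {0..<n} G"
    unfolding copies_iff by (fastforce simp: embeddings_def edge_image_def)
qed

lemma contains_copy_iff_embedding:
  assumes "is_graph V E"
  shows "contains_copy V E {0..<n} G \<longleftrightarrow> (\<exists>g\<in>embeddings V n. edge_image g E \<subseteq> G)"
  unfolding contains_copy_def copies_eq_embeddings[OF assms] by blast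

lemma card_overlap_class_le:
  assumes "finite V"
  shows "card {(g, h) \<in> embeddings V n \<times> embeddings V n. overlap V g h = r} \<le> n ^ (2 * card V - card r)"
    (is "card ?S \<le> _")
proof (cases "?S = {}")
  case False
  then obtain g0 h0 where 0: "g0 \<in> embeddings V n" "h0 \<in> embeddings V n" "overlap V g0 h0 = r" by blast
  have rV: "r \<subseteq> V \<times> V" using 0 by (auto simp: overlap_def)
  have "inj_on snd r"
    using 0 by (force simp: overlap_def inj_on_def embeddings_def)
  then have cr: "card (snd ` r) = card r" by (rule card_image)
  have sr: "snd ` r \<subseteq> V" using rV by auto
  define T where "T = (V \<rightarrow>\<^sub>E {0..<n}) \<times> ((V - snd ` r) \<rightarrow>\<^sub>E {0..<n})"
  have finT: "finite T" using assms by (auto simp: T_def intro!: finite_PiE)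
  define F :: "('a \<Rightarrow> nat) \<times> ('a \<Rightarrow> nat) \<Rightarrow> ('a \<Rightarrow> nat) \<times> ('a \<Rightarrow> nat)"
    where "F = (\<lambda>(g, h). (g, restrict h (V - snd ` r)))"
  have "inj_on F ?S"
  proof (rule inj_onI)
    fix x y assume "x \<in> ?S" "y \<in> ?S" "F x = F y"
    then obtain g h h' where *: "x = (g, h)" "y = (g, h')"
      "h \<in> embeddings V n" "h' \<in> embeddings V n"
      "restrict h (V - snd ` r) = restrict h' (V - snd ` r)" "overlap V g h = r" "overlap V g h' = r"
      by (auto simp: F_def)
    have "h v = h' v" for v
    proof -
      consider "v \<notin> V" | "v \<in> V - snd ` r" | "v \<in> snd ` r" by blast
      then show ?thesis
      proof cases
        case 1
        then show ?thesis using * by (auto simp: embeddings_def PiE_def extensional_def)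
      next
        case 2
        then show ?thesis using *(5) by (metis restrict_apply')
      next
        case 3
        then obtain u where "(u, v) \<in> r" by auto
        then have "(u, v) \<in> overlap V g h" "(u, v) \<in> overlap V g h'" using * by auto
        then show ?thesis by (auto simp: overlap_def)
      qed
    qed
    then show "x = y" using * by auto
  qed
  moreover have "F ` ?S \<subseteq> T"
  proof -
    have "restrict h (V - snd ` r) \<in> (V - snd ` r) \<rightarrow>\<^sub>E {0..<n}" if "h \<in> embeddings V n" for h
      using that by (auto simp: embeddings_def PiE_iff)
    then show ?thesis unfolding F_def T_def by (force simp: embeddings_def)
  qed
  ultimately have "card ?S \<le> card T" using finT by (rule card_inj_on_le)
  also have "card T = n ^ card V * n ^ (card V - card r)"
    using assms sr cr by (simp add: T_def card_cartesian_product card_funcsetE card_Diff_subset finite_subset)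
  also have "\<dots> = n ^ (2 * card V - card r)"
  proof -
    have "card r \<le> card V" using cr card_mono[OF assms sr] by simp
    then show ?thesis by (simp add: power_add[symmetric] mult_2)
  qed
  finally show ?thesis .
next
  case True
  show ?thesis unfolding True by simp
qed

text \<open>The pairs are grouped by overlap type; each group has at most
  \<open>n ^ (2 * card V - card r)\<close> members, so its total is at most
  \<open>B\<close>.\<close>

lemma sum_overlapping_pairs_le:
  fixes B :: real
  assumes V: "finite V" "V \<noteq> {}" and B: "B \<ge> 0" and S: "S \<subseteq> embeddings V n \<times> embeddings V n"
    and le: "\<And>g h. (g, h) \<in> S \<Longrightarrow> real n ^ (2 * card V - card (overlap V g h)) * f (g, h) \<le> B"
  shows "(\<Sum>x\<in>S. f x) \<le> 2 ^ (card V * card V) * B"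
proof -
  let ?cl = "\<lambda>r. {x \<in> S. (\<lambda>(g, h). overlap V g h) x = r}"
  have finS: "finite S" using S finite_embeddings[OF V(1)] by (meson finite_SigmaI finite_subset)
  have "(\<Sum>x\<in>S. f x) = (\<Sum>r\<in>Pow (V \<times> V). \<Sum>x\<in>?cl r. f x)"
    by (rule sum.group[symmetric]) (use finS V in \<open>auto simp: overlap_def\<close>)
  also have "\<dots> \<le> (\<Sum>r\<in>Pow (V \<times> V). B)"
  proof (rule sum_mono)
    fix r
    show "(\<Sum>x\<in>?cl r. f x) \<le> B"
    proof (cases "?cl r = {}")
      case False
      then obtain g0 h0 where 0: "(g0, h0) \<in> S" "overlap V g0 h0 = r" by auto
      obtain v where "v \<in> V" using V by blast
      then have "g0 v \<in> {0..<n}" using 0 S by (fastforce simp: embeddings_def)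
      then have n: "n > 0" by auto
      define D where "D = real n ^ (2 * card V - card r)"
      have D: "D > 0" using n by (simp add: D_def)
      have "(\<Sum>x\<in>?cl r. f x) \<le> (\<Sum>x\<in>?cl r. B / D)"
      proof (rule sum_mono)
        fix x assume "x \<in> ?cl r"
        then obtain g h where x: "x = (g, h)" "(g, h) \<in> S" "overlap V g h = r" by auto
        have "D * f x \<le> B" using le[OF x(2)] x by (simp add: D_def)
        then show "f x \<le> B / D" using D by (simp add: field_simps)
      qed
      also have "\<dots> = real (card (?cl r)) * (B / D)" by simp
      also have "\<dots> \<le> D * (B / D)"
      proof (rule mult_right_mono)
        have "card (?cl r) \<le> card {(g, h) \<in> embeddings V n \<times> embeddings V n. overlap V g h = r}"
          using S finite_embeddings[OF V(1)] by (intro card_mono) (auto intro: finite_subset[of _ "embeddings V n \<times> embeddings V n"])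
        also have "\<dots> \<le> n ^ (2 * card V - card r)" by (rule card_overlap_class_le[OF V(1)])
        finally show "real (card (?cl r)) \<le> D" by (simp add: D_def flip: of_nat_power)
        show "0 \<le> B / D" using B D by simp
      qed
      also have "\<dots> = B" using D by simp
      finally show ?thesis .
    next
      case True
      show ?thesis unfolding True using B by simp
    qed
  qed
  also have "\<dots> = 2 ^ (card V * card V) * B"
    using V by (simp add: card_Pow card_cartesian_product)
  finally show ?thesis .
qed

text \<open>The subgraph is the intersection of the two copies, pulled back along \<open>g\<close>.
  The clauses on \<open>V'\<close> and \<open>(V', E')\<close> make it nonempty and proper for
  distinct intersecting copies, as the first moment requires; the clause on \<open>E'\<close>
  singles out pairs with a common edge for the second moment.\<close>

lemma overlap_subgraph:
  assumes G: "is_graph V E" and gh: "g \<in> embeddings V n" "h \<in> embeddings V n"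
  obtains V' E' where "subgraph V' E' V E" "card V' = card (overlap V g h)"
    "card (edge_image g E \<union> edge_image h E) = 2 * card E - card E'"
    "V' = {} \<longleftrightarrow> g ` V \<inter> h ` V = {}"
    "(V', E') = (V, E) \<longrightarrow> (g ` V, edge_image g E) = (h ` V, edge_image h E)"
    "E' = {} \<longleftrightarrow> edge_image g E \<inter> edge_image h E = {}"
proof
  have inj: "inj_on g V" "inj_on h V" using gh by (auto simp: embeddings_def)
  have fin: "finite V" "finite E" using G finite_edges by (auto simp: is_graph_def)
  let ?V' = "{u \<in> V. g u \<in> h ` V}" and ?E' = "{e \<in> E. g ` e \<in> edge_image h E}"
  show "subgraph ?V' ?E' V E"
  proof -
    have "g u \<in> h ` V" "u \<in> V" if "e \<in> E" "g ` e \<in> edge_image h E" "u \<in> e" for e u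
    proof -
      from that obtain e' where "e' \<in> E" "g ` e = h ` e'" by (auto simp: edge_image_def)
      then have "g u \<in> h ` e'" "e' \<subseteq> V" using that G by (auto simp: is_graph_def)
      then show "g u \<in> h ` V" by blast
      show "u \<in> V" using that G by (auto simp: is_graph_def)
    qed
    then show ?thesis by (auto simp: subgraph_def)
  qed
  have "fst ` overlap V g h = ?V'" by (force simp: overlap_def)
  moreover have "inj_on fst (overlap V g h)"
    using inj by (force simp: overlap_def inj_on_def)
  ultimately show "card ?V' = card (overlap V g h)" by (metis card_image)
  have int: "(\<lambda>e. g ` e) ` ?E' = edge_image g E \<inter> edge_image h E"
    by (auto simp: edge_image_def)
  then have cE': "card ?E' = card (edge_image g E \<inter> edge_image h E)"
    using inj_on_image_edges[OF G inj(1)] by (metis (no_types, lifting) card_image inj_on_subset mem_Collect_eq subsetI)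
  have finI: "finite (edge_image g E)" "finite (edge_image h E)" using fin by (auto simp: edge_image_def)
  from card_Un_Int[OF finI] show "card (edge_image g E \<union> edge_image h E) = 2 * card E - card ?E'"
    unfolding cE' using card_edge_image[OF G inj(1)] card_edge_image[OF G inj(2)] by simp
  show "?V' = {} \<longleftrightarrow> g ` V \<inter> h ` V = {}" by auto
  show "?E' = {} \<longleftrightarrow> edge_image g E \<inter> edge_image h E = {}" using int by auto
  show "(?V', ?E') = (V, E) \<longrightarrow> (g ` V, edge_image g E) = (h ` V, edge_image h E)"
  proof
    assume eq: "(?V', ?E') = (V, E)"
    have "edge_image g E = edge_image g E \<inter> edge_image h E"
      using eq int by (simp add: edge_image_def)
    then have sub: "g ` V \<subseteq> h ` V" "edge_image g E \<subseteq> edge_image h E"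
      using eq by blast+
    have "g ` V = h ` V"
      using sub fin inj by (intro card_subset_eq) (auto simp: card_image)
    moreover have "edge_image g E = edge_image h E"
      using sub finI card_edge_image[OF G inj(1)] card_edge_image[OF G inj(2)] by (intro card_subset_eq) auto
    ultimately show "(g ` V, edge_image g E) = (h ` V, edge_image h E)" by simp
  qed
qed

section \<open>Moment bounds\<close>

text \<open>Covers both the binomial model, where \<open>\<pi> s = q ^ s\<close>, and the process stopped after \<open>m\<close> edges, where
  the inclusion probabilities are ratios of falling factorials.\<close>

locale random_edge_set =
  fixes n :: nat and \<Omega> :: "'w set" and w :: "'w \<Rightarrow> real" and G :: "'w \<Rightarrow> nat set set"
    and \<pi> :: "nat \<Rightarrow> real" and q :: real
  assumes finite_\<Omega>: "finite \<Omega>" and w_nonneg: "x \<in> \<Omega> \<Longrightarrow> 0 \<le> w x" and sum_w: "sum w \<Omega> = 1"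
    and q_nonneg: "0 \<le> q" and q_le_1: "q \<le> 1"
    and incl: "S \<subseteq> pairs n \<Longrightarrow> (\<Sum>x\<in>\<Omega>. if S \<subseteq> G x then w x else 0) = \<pi> (card S)"
    and \<pi>_le: "s \<le> card (pairs n) \<Longrightarrow> \<pi> s \<le> q ^ s"
    and \<pi>_double: "2 * s \<le> card (pairs n) \<Longrightarrow> \<pi> (2 * s) \<le> \<pi> s * \<pi> s"
begin

definition pr :: "('w \<Rightarrow> bool) \<Rightarrow> real" where
  "pr Q = (\<Sum>x\<in>\<Omega>. if Q x then w x else 0)"

lemma pr_mono: "(\<And>x. x \<in> \<Omega> \<Longrightarrow> Q x \<Longrightarrow> R x) \<Longrightarrow> pr Q \<le> pr R"
  unfolding pr_def by (intro sum_mono) (auto intro: w_nonneg)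

lemma pr_nonneg: "0 \<le> pr Q"
  unfolding pr_def by (intro sum_nonneg) (auto intro: w_nonneg)

lemma pr_not: "pr (\<lambda>x. \<not> Q x) = 1 - pr Q"
proof -
  have "pr Q + pr (\<lambda>x. \<not> Q x) = sum w \<Omega>"
    unfolding pr_def sum.distrib[symmetric] by (intro sum.cong) auto
  then show ?thesis using sum_w by simp
qed

lemma pr_le_1: "pr Q \<le> 1"
  using pr_not[of Q] pr_nonneg[of "\<lambda>x. \<not> Q x"] by simp

lemma pr_ex_le:
  assumes "finite C"
  shows "pr (\<lambda>x. \<exists>c\<in>C. Q c x) \<le> (\<Sum>c\<in>C. pr (Q c))"
proof -
  have "(\<Sum>c\<in>C. pr (Q c)) = (\<Sum>x\<in>\<Omega>. \<Sum>c\<in>C. if Q c x then w x else 0)"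
    unfolding pr_def by (rule sum.swap)
  moreover have "(if \<exists>c\<in>C. Q c x then w x else 0) \<le> (\<Sum>c\<in>C. if Q c x then w x else 0)" if "x \<in> \<Omega>" for x
  proof (cases "\<exists>c\<in>C. Q c x")
    case True
    then obtain c where c: "c \<in> C" "Q c x" by blast
    have "(if Q c x then w x else 0) \<le> (\<Sum>c\<in>C. if Q c x then w x else 0)"
      using assms c w_nonneg[OF that] by (intro member_le_sum) auto
    then show ?thesis using c by auto
  next
    case False
    then show ?thesis by (simp add: sum_nonneg)
  qed
  ultimately show ?thesis unfolding pr_def by (simp add: sum_mono)
qed

lemma pr_disj_le: "pr (\<lambda>x. Q x \<or> R x) \<le> pr Q + pr R"
  unfolding pr_def sum.distrib[symmetric] by (intro sum_mono) (auto intro: w_nonneg)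

lemma pr_subset_le:
  assumes "S \<subseteq> pairs n"
  shows "pr (\<lambda>x. S \<subseteq> G x) \<le> q ^ card S"
  using incl[OF assms] \<pi>_le[OF card_mono[OF finite_pairs assms]] by (simp add: pr_def)

lemma first_moment:
  assumes "is_graph V E"
  shows "pr (\<lambda>x. contains_copy V E {0..<n} (G x)) \<le> real n ^ card V * q ^ card E"
proof -
  have fin: "finite V" using assms by (simp add: is_graph_def)
  have "pr (\<lambda>x. contains_copy V E {0..<n} (G x)) \<le> (\<Sum>g\<in>embeddings V n. pr (\<lambda>x. edge_image g E \<subseteq> G x))"
    unfolding contains_copy_iff_embedding[OF assms] by (rule pr_ex_le[OF finite_embeddings[OF fin]])
  also have "\<dots> \<le> (\<Sum>g\<in>embeddings V n. q ^ card E)"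
  proof (rule sum_mono)
    fix g assume g: "g \<in> embeddings V n"
    then have "card (edge_image g E) = card E"
      using card_edge_image[OF assms] by (auto simp: embeddings_def)
    with pr_subset_le[OF edge_image_subset_pairs[OF assms g]]
    show "pr (\<lambda>x. edge_image g E \<subseteq> G x) \<le> q ^ card E" by simp
  qed
  also have "\<dots> = real (card (embeddings V n)) * q ^ card E" by simp
  also have "\<dots> \<le> real (n ^ card V) * q ^ card E"
    using card_embeddings_le[OF fin, of n] q_nonneg by (intro mult_right_mono) auto
  finally show ?thesis by simp
qed

text \<open>Union bound over pairs of embeddings by intersection type. \<open>E'\<close> may be
  empty here, since copies that share only vertices must be excluded too.\<close>

lemma first_moment_overlapping:
  assumes H: "is_graph V E" "V \<noteq> {}" and B: "B \<ge> 0"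
    and le: "\<And>V' E'. subgraph V' E' V E \<Longrightarrow> V' \<noteq> {} \<Longrightarrow> (V', E') \<noteq> (V, E) \<Longrightarrow>
      real n ^ (2 * card V - card V') * q ^ (2 * card E - card E') \<le> B"
  shows "pr (\<lambda>x. \<exists>C\<in>copies V E {0..<n} (G x). \<exists>D\<in>copies V E {0..<n} (G x). C \<noteq> D \<and> fst C \<inter> fst D \<noteq> {})
      \<le> 2 ^ (card V * card V) * B"
proof -
  have fin: "finite V" using H by (simp add: is_graph_def)
  define S where "S = {(g, h) \<in> embeddings V n \<times> embeddings V n. g ` V \<inter> h ` V \<noteq> {}
      \<and> (g ` V, edge_image g E) \<noteq> (h ` V, edge_image h E)}"
  have finS: "finite S"
    by (rule finite_subset[of _ "embeddings V n \<times> embeddings V n"])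
      (use finite_embeddings[OF fin] in \<open>auto simp: S_def\<close>)
  have "pr (\<lambda>x. \<exists>C\<in>copies V E {0..<n} (G x). \<exists>D\<in>copies V E {0..<n} (G x). C \<noteq> D \<and> fst C \<inter> fst D \<noteq> {})
     \<le> pr (\<lambda>x. \<exists>y\<in>S. edge_image (fst y) E \<union> edge_image (snd y) E \<subseteq> G x)"
  proof (rule pr_mono)
    fix x assume "\<exists>C\<in>copies V E {0..<n} (G x). \<exists>D\<in>copies V E {0..<n} (G x). C \<noteq> D \<and> fst C \<inter> fst D \<noteq> {}"
    then obtain C D where CD: "C \<in> copies V E {0..<n} (G x)" "D \<in> copies V E {0..<n} (G x)" "C \<noteq> D" "fst C \<inter> fst D \<noteq> {}"
      by blast
    from CD(1) obtain g where g: "g \<in> embeddings V n" "edge_image g E \<subseteq> G x" "C = (g ` V, edge_image g E)"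
      unfolding copies_eq_embeddings[OF H(1)] by blast
    from CD(2) obtain h where h: "h \<in> embeddings V n" "edge_image h E \<subseteq> G x" "D = (h ` V, edge_image h E)"
      unfolding copies_eq_embeddings[OF H(1)] by blast
    have "(g, h) \<in> S" using g h CD(3,4) by (simp add: S_def)
    then show "\<exists>y\<in>S. edge_image (fst y) E \<union> edge_image (snd y) E \<subseteq> G x"
      using g h by (intro bexI[of _ "(g, h)"]) simp_all
  qed
  also have "\<dots> \<le> (\<Sum>y\<in>S. pr (\<lambda>x. edge_image (fst y) E \<union> edge_image (snd y) E \<subseteq> G x))"
    by (rule pr_ex_le[OF finS])
  also have "\<dots> \<le> (\<Sum>y\<in>S. q ^ card (edge_image (fst y) E \<union> edge_image (snd y) E))"
    by (intro sum_mono pr_subset_le Un_least edge_image_subset_pairs[OF H(1)]) (auto simp: S_def)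
  also have "\<dots> \<le> 2 ^ (card V * card V) * B"
  proof (rule sum_overlapping_pairs_le[OF fin H(2) B, of S n])
    show "S \<subseteq> embeddings V n \<times> embeddings V n" by (auto simp: S_def)
    fix g h assume gh: "(g, h) \<in> S"
    then have "g \<in> embeddings V n" "h \<in> embeddings V n" by (auto simp: S_def)
    then obtain V' E' where *: "subgraph V' E' V E" "card V' = card (overlap V g h)"
      "card (edge_image g E \<union> edge_image h E) = 2 * card E - card E'"
      "V' = {} \<longleftrightarrow> g ` V \<inter> h ` V = {}"
      "(V', E') = (V, E) \<longrightarrow> (g ` V, edge_image g E) = (h ` V, edge_image h E)"
      by (rule overlap_subgraph[OF H(1)])
    have "V' \<noteq> {}" "(V', E') \<noteq> (V, E)" using gh *(4,5) by (auto simp: S_def)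
    from le[OF *(1) this] show "real n ^ (2 * card V - card (overlap V g h)) *
        q ^ card (edge_image (fst (g, h)) E \<union> edge_image (snd (g, h)) E) \<le> B"
      using * by simp
  qed
  finally show ?thesis .
qed

text \<open>Chebyshev's inequality for the number \<open>X\<close> of embeddings. The parameter
  \<kappa> allows for inclusion probabilities that are below \<open>q ^ card E\<close> by a constant
  factor, as happens in the process.\<close>

lemma second_moment:
  assumes F: "is_graph V E" "V \<noteq> {}" and d: "d > 0"
    and dens: "\<And>V' E'. subgraph V' E' V E \<Longrightarrow> real (card E') \<le> d * real (card V')"
    and n: "2 * card V \<le> n" and q: "q > 0" and nq: "real n * q powr d \<ge> 1"
    and \<kappa>: "\<kappa> > 0" "\<kappa> * q ^ card E \<le> \<pi> (card E)"
  shows "pr (\<lambda>x. \<not> contains_copy V E {0..<n} (G x))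
      \<le> (2 ^ (card V * card V) * 4 ^ card V / \<kappa>\<^sup>2) / (real n * q powr d)"
proof -
  define k where "k = card V"
  define e where "e = card E"
  have fin: "finite V" "finite E" using F finite_edges by (auto simp: is_graph_def)
  have "k > 0" using F fin by (simp add: k_def card_gt_0_iff)
  then have n0: "n > 0" using n by (simp add: k_def)
  define Em where "Em = embeddings V n"
  have finEm: "finite Em" using finite_embeddings[OF fin(1)] by (simp add: Em_def)
  define ind where "ind g x = (if edge_image g E \<subseteq> G x then 1 else 0 :: real)" for g x
  define X where "X x = (\<Sum>g\<in>Em. ind g x)" for x
  define \<mu> where "\<mu> = real (card Em) * \<pi> e"
  \<comment> \<open>The square of the order of magnitude of \<mu>, divided by the one factor
    \<open>n * q powr d\<close> that every pair with a common edge loses.\<close>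
  define B where "B = real n ^ (2 * k) * q ^ (2 * e) / (real n * q powr d)"
  have nq0: "real n * q powr d > 0" using nq by linarith
  have B: "B \<ge> 0" using nq0 q by (simp add: B_def)
  have sub: "edge_image g E \<subseteq> pairs n" "card (edge_image g E) = e" if "g \<in> Em" for g
    using edge_image_subset_pairs[OF F(1)] card_edge_image[OF F(1)] that by (auto simp: Em_def e_def embeddings_def)
  have EX: "(\<Sum>x\<in>\<Omega>. w x * X x) = \<mu>"
  proof -
    have "(\<Sum>x\<in>\<Omega>. w x * X x) = (\<Sum>g\<in>Em. \<Sum>x\<in>\<Omega>. w x * ind g x)"
      unfolding X_def sum_distrib_left by (rule sum.swap)
    also have "\<dots> = (\<Sum>g\<in>Em. \<pi> e)"
    proof (rule sum.cong[OF refl])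
      fix g assume g: "g \<in> Em"
      have "(\<Sum>x\<in>\<Omega>. w x * ind g x) = (\<Sum>x\<in>\<Omega>. if edge_image g E \<subseteq> G x then w x else 0)"
        by (intro sum.cong) (auto simp: ind_def)
      then show "(\<Sum>x\<in>\<Omega>. w x * ind g x) = \<pi> e" using incl[OF sub(1)[OF g]] sub(2)[OF g] by simp
    qed
    finally show ?thesis by (simp add: \<mu>_def)
  qed
  let ?un = "\<lambda>y. edge_image (fst y) E \<union> edge_image (snd y) E"
  have EX2: "(\<Sum>x\<in>\<Omega>. w x * (X x)\<^sup>2) \<le> \<mu>\<^sup>2 + 2 ^ (k * k) * B"
  proof -
    have "(X x)\<^sup>2 = (\<Sum>y\<in>Em \<times> Em. if ?un y \<subseteq> G x then 1 else 0)" for x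
    proof -
      have "(X x)\<^sup>2 = (\<Sum>y\<in>Em \<times> Em. ind (fst y) x * ind (snd y) x)"
        unfolding X_def power2_eq_square sum_product sum.cartesian_product by (simp add: case_prod_beta)
      also have "\<dots> = (\<Sum>y\<in>Em \<times> Em. if ?un y \<subseteq> G x then 1 else 0)"
        by (intro sum.cong) (auto simp: ind_def)
      finally show ?thesis .
    qed
    then have "(\<Sum>x\<in>\<Omega>. w x * (X x)\<^sup>2) = (\<Sum>x\<in>\<Omega>. \<Sum>y\<in>Em \<times> Em. w x * (if ?un y \<subseteq> G x then 1 else 0))"
      by (simp add: sum_distrib_left)
    also have "\<dots> = (\<Sum>y\<in>Em \<times> Em. \<Sum>x\<in>\<Omega>. w x * (if ?un y \<subseteq> G x then 1 else 0))"
      by (rule sum.swap)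
    also have "\<dots> = (\<Sum>y\<in>Em \<times> Em. \<pi> (card (?un y)))"
    proof (rule sum.cong[OF refl])
      fix y assume "y \<in> Em \<times> Em"
      then have "?un y \<subseteq> pairs n" using sub(1)[of "fst y"] sub(1)[of "snd y"] by (simp add: mem_Times_iff)
      from incl[OF this] show "(\<Sum>x\<in>\<Omega>. w x * (if ?un y \<subseteq> G x then 1 else 0)) = \<pi> (card (?un y))"
        by (simp add: if_distrib[of "\<lambda>z. _ * z"] cong: if_cong)
    qed
    finally have 1: "(\<Sum>x\<in>\<Omega>. w x * (X x)\<^sup>2) = (\<Sum>y\<in>Em \<times> Em. \<pi> (card (?un y)))" .
    \<comment> \<open>Only common edges create positive correlation. Pairs sharing at most vertices
      are governed by \<open>\<pi>_double\<close> and stay within the main term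
      \<open>\<mu>\<^sup>2\<close>.\<close>
    define S where "S = {y \<in> Em \<times> Em. edge_image (fst y) E \<inter> edge_image (snd y) E \<noteq> {}}"
    have S: "S \<subseteq> Em \<times> Em" by (auto simp: S_def)
    have "(\<Sum>y\<in>Em \<times> Em. \<pi> (card (?un y))) = (\<Sum>y\<in>Em \<times> Em - S. \<pi> (card (?un y))) + (\<Sum>y\<in>S. \<pi> (card (?un y)))"
      using finEm S by (intro sum.subset_diff) auto
    also have "\<dots> \<le> (\<Sum>y\<in>Em \<times> Em - S. \<pi> e * \<pi> e) + (\<Sum>y\<in>S. q ^ card (?un y))"
    proof (intro add_mono sum_mono)
      fix y assume "y \<in> Em \<times> Em - S"
      then have y: "fst y \<in> Em" "snd y \<in> Em" "edge_image (fst y) E \<inter> edge_image (snd y) E = {}"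
        by (auto simp: S_def)
      have "finite (edge_image (fst y) E)" "finite (edge_image (snd y) E)"
        using fin by (auto simp: edge_image_def)
      then have "card (?un y) = 2 * e" using y sub by (simp add: card_Un_disjoint)
      moreover have "card (?un y) \<le> card (pairs n)"
        using y sub by (intro card_mono finite_pairs) auto
      ultimately show "\<pi> (card (?un y)) \<le> \<pi> e * \<pi> e" using \<pi>_double[of e] by simp
    next
      fix y assume "y \<in> S"
      then have "?un y \<subseteq> pairs n" using sub(1)[of "fst y"] sub(1)[of "snd y"] by (simp add: S_def mem_Times_iff)
      then show "\<pi> (card (?un y)) \<le> q ^ card (?un y)" by (intro \<pi>_le card_mono finite_pairs)
    qed
    also have "(\<Sum>y\<in>Em \<times> Em - S. \<pi> e * \<pi> e) \<le> (\<Sum>y\<in>Em \<times> Em. \<pi> e * \<pi> e)"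
      using finEm by (intro sum_mono2) auto
    also have "\<dots> = \<mu>\<^sup>2" by (simp add: \<mu>_def power2_eq_square card_cartesian_product)
    also have "(\<Sum>y\<in>S. q ^ card (?un y)) \<le> 2 ^ (k * k) * B"
      unfolding k_def
    proof (rule sum_overlapping_pairs_le[OF fin(1) F(2) B, of S n])
      show "S \<subseteq> embeddings V n \<times> embeddings V n" using S by (simp add: Em_def)
      fix g h assume gh: "(g, h) \<in> S"
      then have "g \<in> embeddings V n" "h \<in> embeddings V n" using S by (auto simp: Em_def)
      then obtain V' E' where *: "subgraph V' E' V E" "card V' = card (overlap V g h)"
        "card (edge_image g E \<union> edge_image h E) = 2 * card E - card E'"
        "E' = {} \<longleftrightarrow> edge_image g E \<inter> edge_image h E = {}"
        by (rule overlap_subgraph[OF F(1)])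
      have "E' \<noteq> {}" using gh *(4) by (auto simp: S_def)
      define j where "j = card V'"
      define i where "i = card E'"
      have i: "i \<le> e" using *(1) fin by (auto simp: i_def e_def subgraph_def intro: card_mono)
      have j: "j \<le> k" using *(1) fin by (auto simp: j_def k_def subgraph_def intro: card_mono)
      have "finite E'" using *(1) fin finite_subset by (auto simp: subgraph_def)
      then have "i > 0" using \<open>E' \<noteq> {}\<close> by (simp add: i_def card_gt_0_iff)
      moreover have ij: "real i \<le> d * real j" using dens[OF *(1)] by (simp add: i_def j_def)
      ultimately have j0: "j > 0" using gr0I by fastforce
      \<comment> \<open>A common edge forces \<open>j > 0\<close>, so one factor is at most the
        \<open>j\<close>-th power. In that power \<open>q powr (d * j)\<close> is at most
        \<open>q powr i\<close>, because \<open>i \<le> d * j\<close> and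
        \<open>q \<le> 1\<close>.\<close>
      have "(real n * q powr d) * (real n ^ (2 * k - j) * q ^ (2 * e - i)) \<le>
          (real n * q powr d) ^ j * (real n ^ (2 * k - j) * q ^ (2 * e - i))"
        using nq j0 q by (intro mult_right_mono self_le_power) auto
      also have "\<dots> = real n ^ (j + (2 * k - j)) * (q powr (d * real j) * q ^ (2 * e - i))"
        using q by (simp add: power_mult_distrib power_add powr_powr[symmetric] powr_realpow)
      also have "\<dots> \<le> real n ^ (j + (2 * k - j)) * (q powr (real i) * q ^ (2 * e - i))"
        using q q_le_1 ij by (intro mult_left_mono mult_right_mono powr_mono') auto
      also have "\<dots> = real n ^ (2 * k) * q ^ (2 * e)"
        using q i j by (simp add: powr_realpow power_add[symmetric])
      finally have "real n ^ (2 * k - j) * q ^ (2 * e - i) \<le> B"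
        unfolding B_def using nq0 by (simp add: field_simps)
      then show "real n ^ (2 * card V - card (overlap V g h)) *
          q ^ card (edge_image (fst (g, h)) E \<union> edge_image (snd (g, h)) E) \<le> B"
        using * by (simp add: i_def j_def k_def e_def)
    qed
    finally show ?thesis unfolding 1 by simp
  qed
  \<comment> \<open>Without a copy \<open>X x = 0\<close>, so such an outcome contributes its full
    weight times \<open>\<mu>\<^sup>2\<close> to the variance.\<close>
  have "pr (\<lambda>x. \<not> contains_copy V E {0..<n} (G x)) * \<mu>\<^sup>2 \<le> (\<Sum>x\<in>\<Omega>. w x * (X x - \<mu>)\<^sup>2)"
    unfolding pr_def sum_distrib_right
  proof (rule sum_mono)
    fix x assume x: "x \<in> \<Omega>"
    show "(if \<not> contains_copy V E {0..<n} (G x) then w x else 0) * \<mu>\<^sup>2 \<le> w x * (X x - \<mu>)\<^sup>2"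
    proof (cases "contains_copy V E {0..<n} (G x)")
      case False
      then have "X x = 0"
        unfolding contains_copy_iff_embedding[OF F(1)] X_def by (intro sum.neutral) (auto simp: ind_def Em_def)
      then show ?thesis using False by simp
    qed (use w_nonneg[OF x] in simp)
  qed
  also have "\<dots> = (\<Sum>x\<in>\<Omega>. w x * (X x)\<^sup>2) - 2 * \<mu> * (\<Sum>x\<in>\<Omega>. w x * X x) + \<mu>\<^sup>2 * sum w \<Omega>"
    by (simp add: power2_diff algebra_simps sum.distrib sum_subtractf sum_distrib_left sum_distrib_right)
  also have "\<dots> = (\<Sum>x\<in>\<Omega>. w x * (X x)\<^sup>2) - \<mu>\<^sup>2"
    unfolding EX sum_w by (simp add: power2_eq_square)
  also have "\<dots> \<le> 2 ^ (k * k) * B" using EX2 by simp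
  finally have cheb: "pr (\<lambda>x. \<not> contains_copy V E {0..<n} (G x)) * \<mu>\<^sup>2 \<le> 2 ^ (k * k) * B" .
  \<comment> \<open>An explicit lower bound for \<mu>; the factor \<open>4 ^ k\<close> of the final
    bound comes from squaring \<open>(n / 2) ^ k\<close>.\<close>
  define \<nu> where "\<nu> = (real n / 2) ^ k * (\<kappa> * q ^ e)"
  have \<nu>: "\<nu> > 0" using n0 q \<kappa> by (simp add: \<nu>_def)
  have "\<nu> \<le> \<mu>"
    unfolding \<nu>_def \<mu>_def Em_def k_def e_def
    using card_embeddings_ge[OF fin(1) n] \<kappa> q by (intro mult_mono) auto
  then have "pr (\<lambda>x. \<not> contains_copy V E {0..<n} (G x)) * \<nu>\<^sup>2 \<le> pr (\<lambda>x. \<not> contains_copy V E {0..<n} (G x)) * \<mu>\<^sup>2"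
    using \<nu> pr_nonneg by (intro mult_left_mono power_mono) auto
  with cheb have "pr (\<lambda>x. \<not> contains_copy V E {0..<n} (G x)) * \<nu>\<^sup>2 \<le> 2 ^ (k * k) * B" by linarith
  then have "pr (\<lambda>x. \<not> contains_copy V E {0..<n} (G x)) \<le> 2 ^ (k * k) * B / \<nu>\<^sup>2"
    using \<nu> by (simp add: field_simps)
  also have "\<dots> = (2 ^ (k * k) * 4 ^ k / \<kappa>\<^sup>2) / (real n * q powr d)"
  proof -
    have four: "(4::real) ^ k = (2 ^ k)\<^sup>2"
      by (simp add: power2_eq_square power_mult_distrib[symmetric])
    have \<nu>2: "\<nu>\<^sup>2 = real n ^ (2 * k) * q ^ (2 * e) * \<kappa>\<^sup>2 / 4 ^ k"
      unfolding \<nu>_def four by (simp add: power_mult_distrib power_divide mult_ac) (simp add: power_mult)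
    show ?thesis unfolding \<nu>2 B_def using n0 q \<kappa>(1) nq0 by (simp add: field_simps)
  qed
  finally show ?thesis by (simp add: k_def)
qed

end

section \<open>The two random graph models\<close>

lemma random_edge_set_gnp:
  assumes "0 \<le> p" "p \<le> 1"
  shows "random_edge_set n (Pow (pairs n)) (\<lambda>E. p ^ card E * (1 - p) ^ (card (pairs n) - card E))
     (\<lambda>E. E) (\<lambda>s. p ^ s) p"
proof
  let ?X = "pairs n"
  note fin = finite_pairs[of n]
  have total: "(\<Sum>E\<in>Pow Y. p ^ card E * (1 - p) ^ (card Y - card E)) = 1" if "finite Y" for Y :: "nat set set"
  proof -
    have "1 = (\<Prod>x\<in>Y. p + (1 - p))" by simp
    also have "\<dots> = (\<Sum>E\<in>Pow Y. (\<Prod>x\<in>E. p) * (\<Prod>x\<in>Y - E. 1 - p))" by (rule prod_add[OF that])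
    also have "\<dots> = (\<Sum>E\<in>Pow Y. p ^ card E * (1 - p) ^ (card Y - card E))"
      using that by (intro sum.cong) (auto simp: card_Diff_subset finite_subset)
    finally show ?thesis by simp
  qed
  show "sum (\<lambda>E. p ^ card E * (1 - p) ^ (card ?X - card E)) (Pow ?X) = 1" by (rule total[OF fin])
  fix S assume S: "S \<subseteq> ?X"
  have finS: "finite S" using S fin finite_subset by blast
  have "(\<Sum>E\<in>Pow ?X. if S \<subseteq> E then p ^ card E * (1 - p) ^ (card ?X - card E) else 0)
     = (\<Sum>E\<in>{E \<in> Pow ?X. S \<subseteq> E}. p ^ card E * (1 - p) ^ (card ?X - card E))"
    using fin by (subst sum.inter_filter) auto
  also have "\<dots> = (\<Sum>E\<in>Pow (?X - S). p ^ card S * (p ^ card E * (1 - p) ^ (card (?X - S) - card E)))"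
  proof (rule sum.reindex_bij_witness[of _ "\<lambda>E. S \<union> E" "\<lambda>E. E - S"])
    fix E assume "E \<in> {E \<in> Pow ?X. S \<subseteq> E}"
    then have E: "S \<subseteq> E" "E \<subseteq> ?X" by auto
    then have "finite E" using fin finite_subset by blast
    have c: "card E = card S + card (E - S)"
      using E finS \<open>finite E\<close> by (metis card_Diff_subset card_mono le_add_diff_inverse)
    have "card (?X - S) = card ?X - card S" using S finS by (intro card_Diff_subset)
    then show "p ^ card S * (p ^ card (E - S) * (1 - p) ^ (card (?X - S) - card (E - S))) =
        p ^ card E * (1 - p) ^ (card ?X - card E)"
      unfolding c by (simp add: power_add)
  qed (use S in auto)
  also have "\<dots> = p ^ card S"
    unfolding sum_distrib_left[symmetric] using total[of "?X - S"] fin by simp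
  finally show "(\<Sum>E\<in>Pow ?X. if S \<subseteq> E then p ^ card E * (1 - p) ^ (card ?X - card E) else 0) = p ^ card S" .
qed (use assms finite_pairs in \<open>auto simp: mult_2 power_add\<close>)

section \<open>Inclusion probabilities in the stopped process\<close>

lemma card_permutations_take_eq:
  assumes "finite X" "A \<subseteq> X"
  shows "card {\<sigma> \<in> permutations_of_set X. set (take (card A) \<sigma>) = A} = fact (card A) * fact (card X - card A)"
proof -
  let ?S = "{\<sigma> \<in> permutations_of_set X. set (take (card A) \<sigma>) = A}"
  have finA: "finite A" using assms finite_subset by blast
  \<comment> \<open>Cutting an ordering after \<open>card A\<close> entries gives independent
    orderings of \<open>A\<close> and of its complement.\<close>
  have "bij_betw (\<lambda>\<sigma>. (take (card A) \<sigma>, drop (card A) \<sigma>)) ?S (permutations_of_set A \<times> permutations_of_set (X - A))"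
  proof (rule bij_betw_byWitness[where f' = "\<lambda>(x, y). x @ y"])
    show "(\<lambda>\<sigma>. (take (card A) \<sigma>, drop (card A) \<sigma>)) ` ?S \<subseteq> permutations_of_set A \<times> permutations_of_set (X - A)"
    proof
      fix z assume "z \<in> (\<lambda>\<sigma>. (take (card A) \<sigma>, drop (card A) \<sigma>)) ` ?S"
      then obtain \<sigma> where \<sigma>: "z = (take (card A) \<sigma>, drop (card A) \<sigma>)" "set \<sigma> = X" "distinct \<sigma>" "set (take (card A) \<sigma>) = A"
        by (auto simp: permutations_of_set_def)
      have "set \<sigma> = set (take (card A) \<sigma>) \<union> set (drop (card A) \<sigma>)"
        by (metis append_take_drop_id set_append)
      moreover have "set (take (card A) \<sigma>) \<inter> set (drop (card A) \<sigma>) = {}"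
        using \<sigma>(3) by (simp add: set_take_disj_set_drop_if_distinct)
      ultimately have "set (drop (card A) \<sigma>) = X - A" using \<sigma> by auto
      with \<sigma> show "z \<in> permutations_of_set A \<times> permutations_of_set (X - A)"
        by (auto simp: permutations_of_set_def)
    qed
    show "(\<lambda>(x, y). x @ y) ` (permutations_of_set A \<times> permutations_of_set (X - A)) \<subseteq> ?S"
      using assms by (auto simp: permutations_of_set_def distinct_card)
    show "\<forall>\<sigma>\<in>?S. (case (take (card A) \<sigma>, drop (card A) \<sigma>) of (x, y) \<Rightarrow> x @ y) = \<sigma>" by simp
    show "\<forall>z\<in>permutations_of_set A \<times> permutations_of_set (X - A).
      (take (card A) (case z of (x, y) \<Rightarrow> x @ y), drop (card A) (case z of (x, y) \<Rightarrow> x @ y)) = z"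
      by (auto simp: permutations_of_set_def distinct_card)
  qed
  then have "card ?S = card (permutations_of_set A \<times> permutations_of_set (X - A))" by (rule bij_betw_same_card)
  then show ?thesis
    using assms finA by (simp add: card_cartesian_product card_Diff_subset)
qed

lemma card_supersets:
  assumes "finite X" "S \<subseteq> X" "card S \<le> m"
  shows "card {A. S \<subseteq> A \<and> A \<subseteq> X \<and> card A = m} = (card X - card S) choose (m - card S)"
proof -
  have finS: "finite S" using assms finite_subset by blast
  have "bij_betw (\<lambda>A. A - S) {A. S \<subseteq> A \<and> A \<subseteq> X \<and> card A = m} {B. B \<subseteq> X - S \<and> card B = m - card S}"
  proof (rule bij_betw_byWitness[where f' = "\<lambda>B. S \<union> B"])
    show "(\<union>) S ` {B. B \<subseteq> X - S \<and> card B = m - card S} \<subseteq> {A. S \<subseteq> A \<and> A \<subseteq> X \<and> card A = m}"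
    proof clarsimp
      fix B assume B: "B \<subseteq> X - S" "card B = m - card S"
      then have "finite B" using assms finite_subset by blast
      then have "card (S \<union> B) = card S + card B" using B finS by (intro card_Un_disjoint) auto
      then show "S \<subseteq> X \<and> B \<subseteq> X \<and> card (S \<union> B) = m" using B assms by auto
    qed
  qed (use finS in \<open>auto simp: card_Diff_subset\<close>)
  then have "card {A. S \<subseteq> A \<and> A \<subseteq> X \<and> card A = m} = card {B. B \<subseteq> X - S \<and> card B = m - card S}"
    by (rule bij_betw_same_card)
  also have "\<dots> = card (X - S) choose (m - card S)" using assms by (intro n_subsets) auto
  finally show ?thesis using assms finS by (simp add: card_Diff_subset)
qed

text \<open>The first \<open>m\<close> entries form a uniformly random \<open>m\<close>-set, so a
  binomial coefficient counts the favourable ones; absorbing one element of \<open>S\<close> at a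
  time turns it into the product.\<close>

lemma card_permutations_subset_take:
  assumes X: "finite X" and S: "S \<subseteq> X" and m: "m \<le> card X"
  shows "real (card {\<sigma> \<in> permutations_of_set X. S \<subseteq> set (take m \<sigma>)}) / fact (card X)
    = (\<Prod>i<card S. real (m - i) / real (card X - i))"
proof (cases "card S \<le> m")
  case True
  define N where "N = card X"
  define \<A> where "\<A> = {A. S \<subseteq> A \<and> A \<subseteq> X \<and> card A = m}"
  have fin\<A>: "finite \<A>" by (rule finite_subset[of _ "Pow X"]) (use X in \<open>auto simp: \<A>_def\<close>)
  have "{\<sigma> \<in> permutations_of_set X. S \<subseteq> set (take m \<sigma>)}
     = (\<Union>A\<in>\<A>. {\<sigma> \<in> permutations_of_set X. set (take (card A) \<sigma>) = A})" (is "?L = ?R")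
  proof (intro equalityI subsetI)
    fix \<sigma> assume "\<sigma> \<in> ?L"
    then have \<sigma>: "\<sigma> \<in> permutations_of_set X" "set \<sigma> = X" "distinct \<sigma>" "S \<subseteq> set (take m \<sigma>)"
      by (auto simp: permutations_of_set_def)
    have "card (set (take m \<sigma>)) = m"
      using \<sigma> m by (simp add: distinct_card[OF distinct_take] distinct_card[symmetric])
    moreover have "set (take m \<sigma>) \<subseteq> X" using \<sigma> by (metis set_take_subset)
    ultimately show "\<sigma> \<in> ?R" using \<sigma> by (auto simp: \<A>_def)
  next
    fix \<sigma> assume "\<sigma> \<in> ?R"
    then show "\<sigma> \<in> ?L" by (auto simp: \<A>_def)
  qed
  then have "card ?L = (\<Sum>A\<in>\<A>. card {\<sigma> \<in> permutations_of_set X. set (take (card A) \<sigma>) = A})"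
    using fin\<A> by (simp only:) (rule card_UN_disjoint, auto simp: \<A>_def)
  also have "\<dots> = (\<Sum>A\<in>\<A>. fact m * fact (N - m))"
    by (intro sum.cong refl) (use card_permutations_take_eq[OF X] in \<open>auto simp: \<A>_def N_def\<close>)
  also have "\<dots> = ((N - card S) choose (m - card S)) * (fact m * fact (N - m))"
    using card_supersets[OF X S True] by (simp add: \<A>_def N_def)
  finally have L: "card ?L = ((N - card S) choose (m - card S)) * (fact m * fact (N - m))" .
  have "real (((N - s) choose (m - s)) * (fact m * fact (N - m))) / fact N
     = (\<Prod>i<s. real (m - i) / real (N - i))" if "s \<le> m" for s
    using that
  proof (induction s)
    case 0
    have "(N choose m) * (fact m * fact (N - m)) = fact N"
      using binomial_fact_lemma[of m N] m by (simp add: N_def mult_ac)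
    then have "real ((N choose m) * (fact m * fact (N - m))) = fact N" by (metis of_nat_fact)
    then show ?case by simp
  next
    case (Suc s)
    have Ns: "N - s > 0" using Suc m by (simp add: N_def)
    have "(m - s) * ((N - s) choose (m - s)) = (N - s) * ((N - Suc s) choose (m - Suc s))"
      using times_binomial_minus1_eq[of "m - s" "N - s"] Suc by simp
    then have "real (m - s) * real ((N - s) choose (m - s)) = real (N - s) * real ((N - Suc s) choose (m - Suc s))"
      by (metis of_nat_mult)
    then have *: "real ((N - Suc s) choose (m - Suc s)) = real ((N - s) choose (m - s)) * (real (m - s) / real (N - s))"
      using Ns by (simp add: field_simps)
    have "real (((N - Suc s) choose (m - Suc s)) * (fact m * fact (N - m))) / fact N
       = (real (((N - s) choose (m - s)) * (fact m * fact (N - m))) / fact N) * (real (m - s) / real (N - s))"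
      unfolding of_nat_mult * by (simp add: mult_ac)
    also have "\<dots> = (\<Prod>i<s. real (m - i) / real (N - i)) * (real (m - s) / real (N - s))"
      by (simp only: Suc.IH[OF Suc_leD[OF Suc.prems]])
    finally show ?case by (simp only: prod.lessThan_Suc)
  qed
  from this[OF True] show ?thesis unfolding L by (simp add: N_def)
next
  case False
  have none: "{\<sigma> \<in> permutations_of_set X. S \<subseteq> set (take m \<sigma>)} = {}"
  proof -
    have "\<not> S \<subseteq> set (take m \<sigma>)" for \<sigma> :: "'a list"
    proof
      assume "S \<subseteq> set (take m \<sigma>)"
      then have "card S \<le> card (set (take m \<sigma>))" by (intro card_mono) auto
      also have "\<dots> \<le> m" using card_length[of "take m \<sigma>"] by simp
      finally show False using False by simp
    qed
    then show ?thesis by blast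
  qed
  \<comment> \<open>More than \<open>m\<close> elements cannot fit, and correspondingly the factor
    with \<open>i = m\<close> has numerator \<open>0\<close>.\<close>
  have zero: "(\<Prod>i<card S. real (m - i) / real (card X - i)) = 0"
    using False by (intro prod_zero) (auto intro!: bexI[of _ m])
  show ?thesis unfolding none zero by simp
qed

text \<open>Drawing without replacement, each hit makes the next one less likely. This yields both
  \<open>\<pi>_le\<close> and \<open>\<pi>_double\<close> for the process; for \<open>j > m\<close>
  truncated subtraction makes the left side \<open>0\<close>.\<close>

lemma ratio_antimono:
  assumes "i \<le> j" "j < N" "m \<le> N"
  shows "real (m - j) / real (N - j) \<le> real (m - i) / real (N - i)"
proof (cases "j \<le> m")
  case True
  have "real (m - j) * real (N - i) \<le> real (m - i) * real (N - j)"
  proof -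
    have "0 \<le> (real j - real i) * (real N - real m)" using assms by (intro mult_nonneg_nonneg) auto
    then show ?thesis using assms True by (simp add: of_nat_diff algebra_simps)
  qed
  then show ?thesis using assms by (simp add: field_simps)
qed simp

lemma random_edge_set_process:
  assumes m: "m \<le> card (pairs n)" and X: "card (pairs n) > 0"
  shows "random_edge_set n (permutations_of_set (pairs n)) (\<lambda>_. 1 / fact (card (pairs n)))
     (\<lambda>\<sigma>. set (take m \<sigma>)) (\<lambda>s. \<Prod>i<s. real (m - i) / real (card (pairs n) - i)) (real m / real (card (pairs n)))"
proof
  let ?N = "card (pairs n)"
  have le: "real (m - i) / real (?N - i) \<le> real m / real ?N" if "i < ?N" for i
    using ratio_antimono[of 0 i ?N m] that m by simp
  show "(\<Prod>i<s. real (m - i) / real (?N - i)) \<le> (real m / real ?N) ^ s" if "s \<le> ?N" for s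
  proof -
    have "(\<Prod>i<s. real (m - i) / real (?N - i)) \<le> (\<Prod>i<s. real m / real ?N)"
      by (intro prod_mono) (use le that in auto)
    then show ?thesis by simp
  qed
  have prod_split: "(\<Prod>i<s + t. f i) = (\<Prod>i<s. f i) * (\<Prod>i<t. f (s + i))" for f :: "nat \<Rightarrow> real" and s t
    by (induction t) (auto simp: mult.assoc)
  show "(\<Prod>i<2 * s. real (m - i) / real (?N - i)) \<le> (\<Prod>i<s. real (m - i) / real (?N - i)) * (\<Prod>i<s. real (m - i) / real (?N - i))"
    if "2 * s \<le> ?N" for s
  proof -
    \<comment> \<open>The second half of the product is the first half with indices shifted by
      \<open>s\<close>, and the shift can only lower each factor.\<close>
    have "(\<Prod>i<2 * s. real (m - i) / real (?N - i)) =
       (\<Prod>i<s. real (m - i) / real (?N - i)) * (\<Prod>i<s. real (m - (s + i)) / real (?N - (s + i)))"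
      unfolding mult_2 by (rule prod_split)
    also have "\<dots> \<le> (\<Prod>i<s. real (m - i) / real (?N - i)) * (\<Prod>i<s. real (m - i) / real (?N - i))"
      using that m by (intro mult_left_mono prod_mono prod_nonneg conjI ratio_antimono) auto
    finally show ?thesis .
  qed
  show "(\<Sum>\<sigma>\<in>permutations_of_set (pairs n). if S \<subseteq> set (take m \<sigma>) then 1 / fact ?N else 0)
      = (\<Prod>i<card S. real (m - i) / real (?N - i))" if "S \<subseteq> pairs n" for S
  proof -
    have "(\<Sum>\<sigma>\<in>permutations_of_set (pairs n). if S \<subseteq> set (take m \<sigma>) then 1 / fact ?N else 0)
      = (\<Sum>\<sigma>\<in>{\<sigma> \<in> permutations_of_set (pairs n). S \<subseteq> set (take m \<sigma>)}. 1 / fact ?N)"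
      by (subst sum.inter_filter) auto
    also have "\<dots> = real (card {\<sigma> \<in> permutations_of_set (pairs n). S \<subseteq> set (take m \<sigma>)}) / fact ?N" by simp
    finally show ?thesis using card_permutations_subset_take[OF finite_pairs that m] by simp
  qed
qed (use m X finite_pairs in auto)

lemma process_prob_eq:
  "process_prob n Q = (\<Sum>\<sigma>\<in>permutations_of_set (pairs n). if Q \<sigma> then 1 / fact (card (pairs n)) else 0)"
proof -
  have "(\<Sum>\<sigma>\<in>permutations_of_set (pairs n). if Q \<sigma> then 1 / fact (card (pairs n)) else 0)
    = (\<Sum>\<sigma>\<in>{\<sigma> \<in> permutations_of_set (pairs n). Q \<sigma>}. 1 / fact (card (pairs n)) :: real)"
    by (subst sum.inter_filter) auto
  then show ?thesis using finite_pairs by (simp add: process_prob_def)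
qed

section \<open>Threshold in the binomial random graph\<close>

definition multi_vertices :: "nat \<Rightarrow> 'h set \<Rightarrow> ('h \<times> nat) set" where
  "multi_vertices N V = V \<times> {..<N}"

definition multi_edges :: "nat \<Rightarrow> 'h set set \<Rightarrow> ('h \<times> nat) set set" where
  "multi_edges N E = (\<lambda>(e, i). e \<times> {i}) ` (E \<times> {..<N})"

lemma is_graph_multi: "is_graph V E \<Longrightarrow> is_graph (multi_vertices N V) (multi_edges N E)"
  by (fastforce simp: is_graph_def multi_vertices_def multi_edges_def card_cartesian_product)

text \<open>A subgraph of the disjoint union splits into layers, each a subgraph of one copy; a
  bound that is linear in the number of vertices is additive over layers. The value \<open>d\<close>
  is left open because both the maximum density and the density of a strictly balanced graph are
  substituted.\<close>

lemma multi_subgraph_density_le: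
  assumes H: "is_graph V E" and d: "d \<ge> 0"
    and dens: "\<And>V' E'. subgraph V' E' V E \<Longrightarrow> real (card E') \<le> d * real (card V')"
    and sub: "subgraph V' E' (multi_vertices N V) (multi_edges N E)"
  shows "real (card E') \<le> d * real (card V')"
proof -
  define Vi where "Vi i = {v. (v, i) \<in> V'}" for i
  define Ei where "Ei i = {e \<in> E. e \<times> {i} \<in> E'}" for i
  have fin: "finite V" "finite E" using H finite_edges by (auto simp: is_graph_def)
  have Vi: "Vi i \<subseteq> V" for i using sub by (auto simp: Vi_def subgraph_def multi_vertices_def)
  have finVi: "finite (Vi i)" for i using Vi fin finite_subset by blast
  have finEi: "finite (Ei i)" for i using fin by (auto simp: Ei_def)
  have subi: "subgraph (Vi i) (Ei i) V E" for i
  proof -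
    have "v \<in> Vi i" if "e \<in> Ei i" "v \<in> e" for e v
    proof -
      have "e \<times> {i} \<subseteq> V'" using that(1) sub by (auto simp: Ei_def subgraph_def)
      then show ?thesis using that(2) by (auto simp: Vi_def)
    qed
    then show ?thesis using Vi by (auto simp: subgraph_def Ei_def)
  qed
  have "E' \<subseteq> (\<lambda>(i, e). e \<times> {i}) ` (SIGMA i:{..<N}. Ei i)"
  proof
    fix x assume x: "x \<in> E'"
    then obtain e i where "e \<in> E" "i < N" "x = e \<times> {i}" using sub by (auto simp: subgraph_def multi_edges_def)
    then show "x \<in> (\<lambda>(i, e). e \<times> {i}) ` (SIGMA i:{..<N}. Ei i)"
      using x by (intro image_eqI[of _ _ "(i, e)"]) (auto simp: Ei_def)
  qed
  then have "card E' \<le> card (SIGMA i:{..<N}. Ei i)"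
    using finEi by (intro surj_card_le) auto
  also have "\<dots> = (\<Sum>i<N. card (Ei i))" using finEi by simp
  finally have "real (card E') \<le> (\<Sum>i<N. real (card (Ei i)))" by (simp flip: of_nat_sum)
  also have "\<dots> \<le> (\<Sum>i<N. d * real (card (Vi i)))" by (intro sum_mono dens subi)
  also have "\<dots> = d * real (\<Sum>i<N. card (Vi i))" by (simp add: sum_distrib_left)
  also have "(\<Sum>i<N. card (Vi i)) = card (SIGMA i:{..<N}. Vi i)" using finVi by simp
  also have "\<dots> = card V'"
  proof -
    have "V' = prod.swap ` (SIGMA i:{..<N}. Vi i)"
      using sub by (force simp: subgraph_def multi_vertices_def Vi_def)
    then show ?thesis by (simp add: card_image)
  qed
  finally show ?thesis .
qed

lemma disjoint_copies_of_multi_copy: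
  assumes "contains_copy (multi_vertices N VH) (multi_edges N EH) V E" "VH \<noteq> {}"
  obtains \<V> where "\<V> \<subseteq> fst ` copies VH EH V E" "disjoint \<V>" "card \<V> = N" "finite \<V>"
proof -
  obtain f where f: "inj_on f (VH \<times> {..<N})" "f ` (VH \<times> {..<N}) \<subseteq> V"
    "\<forall>e\<in>multi_edges N EH. f ` e \<in> E"
    using assms by (auto simp: contains_copy_def copies_def multi_vertices_def)
  define W where "W i = (\<lambda>v. f (v, i)) ` VH" for i
  have disj: "W i \<inter> W j = {}" if "i < N" "j < N" "i \<noteq> j" for i j
    using f(1) that by (fastforce simp: W_def dest: inj_onD)
  have "inj_on W {..<N}"
  proof (rule inj_onI, rule ccontr)
    fix i j assume *: "i \<in> {..<N}" "j \<in> {..<N}" "W i = W j" "i \<noteq> j"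
    have "W i \<noteq> {}" using assms by (auto simp: W_def)
    with * disj[of i j] show False by auto
  qed
  moreover have "W i \<in> fst ` copies VH EH V E" if "i < N" for i
  proof -
    have "inj_on (\<lambda>v. f (v, i)) VH" using f(1) that by (auto simp: inj_on_def)
    moreover have "(\<lambda>v. f (v, i)) ` VH \<subseteq> V" using f(2) that by auto
    moreover have "(\<lambda>v. f (v, i)) ` e \<in> E" if "e \<in> EH" for e
    proof -
      have "e \<times> {i} \<in> multi_edges N EH" using that \<open>i < N\<close> by (auto simp: multi_edges_def)
      moreover have "f ` (e \<times> {i}) = (\<lambda>v. f (v, i)) ` e" by auto
      ultimately show ?thesis using f(3) by metis
    qed
    ultimately have "(W i, (\<lambda>e. (\<lambda>v. f (v, i)) ` e) ` EH) \<in> copies VH EH V E"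
      unfolding copies_iff W_def by blast
    then show ?thesis by (metis fst_conv imageI)
  qed
  moreover have "disjoint (W ` {..<N})"
  proof (rule disjointI)
    fix A B assume "A \<in> W ` {..<N}" "B \<in> W ` {..<N}" "A \<noteq> B"
    then show "A \<inter> B = {}" using disj by auto
  qed
  ultimately show ?thesis by (intro that[of "W ` {..<N}"]) (auto simp: card_image)
qed

section \<open>Maximum density\<close>

lemma max_density_set:
  assumes "is_graph V E"
  shows "finite {density V' E' | V' E'. V' \<noteq> {} \<and> subgraph V' E' V E}"
proof -
  have "{density V' E' | V' E'. V' \<noteq> {} \<and> subgraph V' E' V E} \<subseteq> (\<lambda>(V', E'). density V' E') ` (Pow V \<times> Pow E)"
    by (auto simp: subgraph_def)
  moreover have "finite (Pow V \<times> Pow E)" using assms finite_edges by (auto simp: is_graph_def)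
  ultimately show ?thesis by (meson finite_imageI finite_subset)
qed

lemma subgraph_empty_vertices:
  assumes "is_graph V E" "subgraph {} E' V E"
  shows "E' = {}"
  using assms by (fastforce simp: is_graph_def subgraph_def)

text \<open>The product form also covers \<open>V' = {}\<close>, which can occur as a layer of a
  subgraph of a disjoint union.\<close>

lemma card_edges_le_max_density:
  assumes "is_graph V E" "subgraph V' E' V E"
  shows "real (card E') \<le> max_density V E * real (card V')"
proof (cases "V' = {}")
  case True
  then show ?thesis using subgraph_empty_vertices assms by fastforce
next
  case False
  then have "density V' E' \<le> max_density V E"
    unfolding max_density_def using assms by (intro Max_ge max_density_set) auto
  moreover have "card V' > 0"
    using False assms by (auto simp: card_gt_0_iff is_graph_def subgraph_def intro: finite_subset)
  ultimately show ?thesis by (simp add: density_def field_simps)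
qed

lemma max_density_attained:
  assumes "is_graph V E" "V \<noteq> {}"
  obtains V' E' where "V' \<noteq> {}" "subgraph V' E' V E" "real (card E') = max_density V E * real (card V')"
proof -
  let ?D = "{density V' E' | V' E'. V' \<noteq> {} \<and> subgraph V' E' V E}"
  have "subgraph V E V E" using assms by (auto simp: subgraph_def is_graph_def)
  then have "density V E \<in> ?D" using assms(2) by blast
  then have "max_density V E \<in> ?D"
    unfolding max_density_def using max_density_set[OF assms(1)] by (intro Max_in) auto
  then obtain V' E' where *: "V' \<noteq> {}" "subgraph V' E' V E" "max_density V E = density V' E'" by auto
  then have "card V' > 0"
    using assms by (auto simp: card_gt_0_iff is_graph_def subgraph_def intro: finite_subset)
  with * show ?thesis by (intro that[of V' E']) (auto simp: density_def)
qed

lemma max_density_pos: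
  assumes "is_graph V E" "E \<noteq> {}"
  shows "max_density V E > 0"
proof -
  have "subgraph V E V E" using assms by (auto simp: subgraph_def is_graph_def)
  from card_edges_le_max_density[OF assms(1) this]
  have "real (card E) \<le> max_density V E * real (card V)" .
  moreover have "card E > 0" using assms finite_edges by (auto simp: card_gt_0_iff)
  ultimately have "0 < max_density V E * real (card V)" by linarith
  then show ?thesis by (simp add: zero_less_mult_iff)
qed

text \<open>Following the winning strategy to the end of one play suffices; whenever Avoider is to
  move, he may be assumed to claim everything that is left.\<close>

lemma gwins_imp_final:
  assumes "gwins a b P U A t" "finite U"
  shows "\<exists>X\<subseteq>U. P (A \<union> X)"
  using assms
proof (induction rule: gwins.induct)
  case (final A t)
  then show ?case by auto
next
  case (avoider_move U A)
  from avoider_move(2)[rule_format, of U] avoider_move(1) have "\<exists>X\<subseteq>U - U. P (A \<union> U \<union> X)" by auto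
  then show ?case by auto
next
  case (enforcer_move U S A)
  then show ?case by blast
qed

lemma enforcer_wins_imp_contains_copy:
  assumes "is_graph VH EH" "enforcer_wins_game a b t VH EH n E"
  shows "contains_copy VH EH {0..<n} E"
proof -
  from assms obtain W where "W \<in> fst ` copies VH EH {0..<n} E"
    unfolding enforcer_wins_game_iff_gwins[OF assms(1)] by (fastforce dest: gwins_imp_final)
  then show ?thesis by (auto simp: contains_copy_def)
qed

lemma contains_copy_subgraph:
  assumes "subgraph V' E' VH EH" "contains_copy VH EH V E"
  shows "contains_copy V' E' V E"
proof -
  obtain f where f: "inj_on f VH" "f ` VH \<subseteq> V" "\<forall>e\<in>EH. f ` e \<in> E"
    using assms(2) by (auto simp: contains_copy_def copies_def)
  then have "(f ` V', (\<lambda>e. f ` e) ` E') \<in> copies V' E' V E"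
    unfolding copies_iff using assms(1)
    by (intro exI[of _ f]) (auto simp: subgraph_def intro: inj_on_subset)
  then show ?thesis by (auto simp: contains_copy_def)
qed

lemma tendsto_1_of_complement:
  fixes f g :: "nat \<Rightarrow> real"
  assumes "\<And>n. f n \<le> 1" "eventually (\<lambda>n. 1 - f n \<le> g n) sequentially" "g \<longlonglongrightarrow> 0"
  shows "f \<longlonglongrightarrow> 1"
proof (rule tendsto_sandwich)
  show "eventually (\<lambda>n. 1 - g n \<le> f n) sequentially" using assms(2) by eventually_elim simp
  show "(\<lambda>n. 1 - g n) \<longlonglongrightarrow> 1" using tendsto_diff[OF tendsto_const assms(3), of 1] by simp
qed (use assms(1) in auto)

section \<open>The two sides of the threshold\<close>

lemma gnp_avoider_wins:
  fixes p :: "nat \<Rightarrow> real"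
  assumes H: "is_graph VH EH" "VH \<noteq> {}" "EH \<noteq> {}" and p: "\<And>n. 0 \<le> p n \<and> p n \<le> 1"
    and small: "p \<in> o(\<lambda>n. real n powr (- 1 / max_density VH EH))"
  shows "(\<lambda>n. gnp_prob n (p n) (\<lambda>E. \<not> enforcer_wins_game a b t VH EH n E)) \<longlonglongrightarrow> 1"
proof -
  define d where "d = max_density VH EH"
  have d: "d > 0" using max_density_pos H by (simp add: d_def)
  \<comment> \<open>The expected number of copies of \<open>H\<close> itself need not tend to
    \<open>0\<close>, so the union bound is applied to a densest subgraph instead.\<close>
  obtain V' E' where sub: "V' \<noteq> {}" "subgraph V' E' VH EH" "real (card E') = d * real (card V')"
    using max_density_attained[OF H(1,2)] by (auto simp: d_def)
  have G': "is_graph V' E'"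
    using sub(2) H(1) by (auto simp: is_graph_def subgraph_def intro: finite_subset)
  have v': "card V' > 0" using G' sub(1) by (auto simp: is_graph_def card_gt_0_iff)
  then have e': "real (card E') > 0" using sub(3) d by simp
  \<comment> \<open>As \<open>card V' = card E' / d\<close>, this is just the first moment bound
    \<open>n ^ card V' * p n ^ card E'\<close>.\<close>
  define g where "g n = (p n / real n powr (- 1 / d)) powr (real (card E'))" for n
  have "(\<lambda>n. p n / real n powr (- 1 / d)) \<longlonglongrightarrow> 0"
    using smalloD_tendsto[OF small] by (simp add: d_def)
  then have g0: "g \<longlonglongrightarrow> 0"
    unfolding g_def using e' p by (intro tendsto_zero_powrI[of _ _ "\<lambda>_. real (card E')"]) auto
  show ?thesis
  proof (rule tendsto_1_of_complement[OF _ _ g0])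
    fix n
    interpret random_edge_set n "Pow (pairs n)" "\<lambda>E. p n ^ card E * (1 - p n) ^ (card (pairs n) - card E)"
      "\<lambda>E. E" "\<lambda>s. p n ^ s" "p n"
      by (rule random_edge_set_gnp) (use p in auto)
    have "gnp_prob n (p n) (\<lambda>E. \<not> enforcer_wins_game a b t VH EH n E) = pr (\<lambda>E. \<not> enforcer_wins_game a b t VH EH n E)"
      by (simp add: gnp_prob_def pr_def)
    then show "gnp_prob n (p n) (\<lambda>E. \<not> enforcer_wins_game a b t VH EH n E) \<le> 1" using pr_le_1 by simp
  next
    show "eventually (\<lambda>n. 1 - gnp_prob n (p n) (\<lambda>E. \<not> enforcer_wins_game a b t VH EH n E) \<le> g n) sequentially"
      using eventually_gt_at_top[of 0]
    proof eventually_elim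
      case (elim n)
      interpret random_edge_set n "Pow (pairs n)" "\<lambda>E. p n ^ card E * (1 - p n) ^ (card (pairs n) - card E)"
        "\<lambda>E. E" "\<lambda>s. p n ^ s" "p n"
        by (rule random_edge_set_gnp) (use p in auto)
      have "gnp_prob n (p n) (\<lambda>E. \<not> enforcer_wins_game a b t VH EH n E) = 1 - pr (enforcer_wins_game a b t VH EH n)"
        unfolding pr_not[symmetric] by (simp add: gnp_prob_def pr_def)
      moreover have "pr (enforcer_wins_game a b t VH EH n) \<le> pr (contains_copy V' E' {0..<n})"
        by (intro pr_mono) (metis H(1) enforcer_wins_imp_contains_copy contains_copy_subgraph sub(2))
      moreover have "pr (contains_copy V' E' {0..<n}) \<le> real n ^ card V' * p n ^ card E'"
        by (rule first_moment[OF G'])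
      moreover have "real n ^ card V' * p n ^ card E' = g n"
      proof -
        have "g n = p n powr real (card E') / real n powr (- 1 / d * real (card E'))"
          unfolding g_def using p by (subst powr_divide) (auto simp: powr_powr)
        also have "- 1 / d * real (card E') = - real (card V')" using sub(3) d by simp
        also have "p n powr real (card E') = p n ^ card E'"
          using p e' by (intro powr_realpow') auto
        finally show ?thesis using elim by (simp add: powr_minus powr_realpow field_simps)
      qed
      ultimately show ?case by linarith
    qed
  qed
qed

lemma gnp_enforcer_wins:
  fixes p :: "nat \<Rightarrow> real"
  assumes ab: "a \<ge> 1" "b \<ge> 1"
    and H: "is_graph VH EH" "VH \<noteq> {}" "EH \<noteq> {}" and p: "\<And>n. 0 \<le> p n \<and> p n \<le> 1"
    and large: "(\<lambda>n. real n powr (- 1 / max_density VH EH)) \<in> o(p)"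
  shows "(\<lambda>n. gnp_prob n (p n) (enforcer_wins_game a b t VH EH n)) \<longlonglongrightarrow> 1"
proof -
  define d where "d = max_density VH EH"
  have d: "d > 0" using max_density_pos H by (simp add: d_def)
  define N where "N = (LEAST M. box_value a b t (card VH) M)"
  have N: "box_value a b t (card VH) N"
    unfolding N_def using ex_box_value[OF ab(2)] by (rule LeastI_ex)
  \<comment> \<open>\<open>Suc N\<close> layers make the vertex set nonempty whatever
    \<open>N\<close> is; one of them is discarded later.\<close>
  define V where "V = multi_vertices (Suc N) VH"
  define E where "E = multi_edges (Suc N) EH"
  have VE: "is_graph V E" "V \<noteq> {}"
    using is_graph_multi H by (auto simp: V_def E_def multi_vertices_def)
  have dens: "real (card E') \<le> d * real (card V')" if "subgraph V' E' V E" for V' E'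
    using multi_subgraph_density_le[OF H(1) _ _ that[unfolded V_def E_def], of d] card_edges_le_max_density[OF H(1)] d
    by (simp add: d_def)
  define C where "C = (2 ^ (card V * card V) * 4 ^ card V / (1::real)\<^sup>2)"
  \<comment> \<open>The Chebyshev bound \<open>C / (n * p powr d)\<close>, rewritten through the
    ratio that tends to \<open>0\<close> by assumption.\<close>
  define g where "g n = C * (real n powr (- 1 / d) / p n) powr d" for n
  have "(\<lambda>n. real n powr (- 1 / d) / p n) \<longlonglongrightarrow> 0"
    using smalloD_tendsto[OF large] by (simp add: d_def)
  then have "(\<lambda>n. (real n powr (- 1 / d) / p n) powr d) \<longlonglongrightarrow> 0"
    using d p by (intro tendsto_zero_powrI[of _ _ "\<lambda>_. d"]) auto
  then have g0: "g \<longlonglongrightarrow> 0"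
    unfolding g_def using tendsto_mult_right_zero by blast
  show ?thesis
  proof (rule tendsto_1_of_complement[OF _ _ g0])
    fix n
    interpret random_edge_set n "Pow (pairs n)" "\<lambda>E. p n ^ card E * (1 - p n) ^ (card (pairs n) - card E)"
      "\<lambda>E. E" "\<lambda>s. p n ^ s" "p n"
      by (rule random_edge_set_gnp) (use p in auto)
    have "gnp_prob n (p n) (enforcer_wins_game a b t VH EH n) = pr (enforcer_wins_game a b t VH EH n)"
      by (simp add: gnp_prob_def pr_def)
    then show "gnp_prob n (p n) (enforcer_wins_game a b t VH EH n) \<le> 1" using pr_le_1 by simp
  next
    have ev: "eventually (\<lambda>n. real n powr (- 1 / d) \<le> p n) sequentially"
      using landau_o.smallD[OF large zero_less_one] by eventually_elim (use p in \<open>auto simp: d_def\<close>)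
    show "eventually (\<lambda>n. 1 - gnp_prob n (p n) (enforcer_wins_game a b t VH EH n) \<le> g n) sequentially"
      using ev eventually_gt_at_top[of 0] eventually_ge_at_top[of "2 * card V"]
        eventually_ge_at_top[of "card VH * N + max a b"]
    proof eventually_elim
      case (elim n)
      interpret random_edge_set n "Pow (pairs n)" "\<lambda>E. p n ^ card E * (1 - p n) ^ (card (pairs n) - card E)"
        "\<lambda>E. E" "\<lambda>s. p n ^ s" "p n"
        by (rule random_edge_set_gnp) (use p in auto)
      have pos: "p n > 0" using elim by (intro less_le_trans[OF _ elim(1)]) auto
      have pw: "(real n powr (- 1 / d)) powr d = 1 / real n"
        unfolding powr_powr using elim d by (simp add: powr_minus_divide)
      have "(real n powr (- 1 / d)) powr d \<le> p n powr d"
        using elim d by (intro powr_mono2) auto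
      then have np: "1 \<le> real n * p n powr d"
        unfolding pw using elim by (simp add: field_simps)
      have "gnp_prob n (p n) (enforcer_wins_game a b t VH EH n) = 1 - pr (\<lambda>E. \<not> enforcer_wins_game a b t VH EH n E)"
        unfolding pr_not by (simp add: gnp_prob_def pr_def)
      moreover have "pr (\<lambda>E. \<not> enforcer_wins_game a b t VH EH n E) \<le> pr (\<lambda>F. \<not> contains_copy V E {0..<n} F)"
      proof (intro pr_mono notI)
        fix F assume F: "\<not> enforcer_wins_game a b t VH EH n F" "contains_copy V E {0..<n} F"
        obtain \<V> where \<V>: "\<V> \<subseteq> fst ` copies VH EH {0..<n} F" "disjoint \<V>" "card \<V> = Suc N" "finite \<V>"
          using disjoint_copies_of_multi_copy[OF F(2)[unfolded V_def E_def] H(2)] by blast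
        obtain \<W> where \<W>: "\<W> \<subseteq> \<V>" "card \<W> = N" "finite \<W>"
          using obtain_subset_with_card_n[of N \<V>] \<V> by (metis le_SucI order_refl)
        have "enforcer_wins_game a b t VH EH n F"
          using \<W> \<V>(1) pairwise_subset[OF \<V>(2) \<W>(1)] elim N
          by (intro enforcer_wins_disjoint_copies[OF H(1,2) ab, of \<W> n F N]) auto
        with F(1) show False ..
      qed
      moreover have "pr (\<lambda>F. \<not> contains_copy V E {0..<n} F) \<le> C / (real n * p n powr d)"
        unfolding C_def using VE d dens elim pos np by (intro second_moment) auto
      moreover have "C / (real n * p n powr d) = g n"
      proof -
        have "(real n powr (- 1 / d) / p n) powr d = (real n powr (- 1 / d)) powr d / p n powr d"
          by (rule powr_divide)
        also note pw
        finally show ?thesis by (simp add: g_def)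
      qed
      ultimately show ?case by linarith
    qed
  qed
qed

section \<open>Hitting times in the random graph process\<close>

text \<open>Since \<open>P\<close> and \<open>Q\<close> both hold at time \<open>m\<close>, neither
  least index exceeds \<open>m\<close>, and the behaviour after \<open>m\<close> is
  irrelevant.\<close>

lemma hitting_time_cong:
  assumes iff: "\<And>i. i \<le> m \<Longrightarrow> P (set (take i \<sigma>)) \<longleftrightarrow> Q (set (take i \<sigma>))"
    and P: "P (set (take m \<sigma>))" and m: "m \<le> length \<sigma>"
  shows "hitting_time \<sigma> P = hitting_time \<sigma> Q"
proof -
  define L where "L = (LEAST i. P (set (take i \<sigma>)))"
  have L: "P (set (take L \<sigma>))" "L \<le> m" unfolding L_def using P by (auto intro: LeastI Least_le)
  have "(LEAST i. Q (set (take i \<sigma>))) = L"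
  proof (rule Least_equality)
    show "Q (set (take L \<sigma>))" using L iff by blast
    fix j assume "Q (set (take j \<sigma>))"
    then show "L \<le> j" using iff[of j] L by (cases "j \<le> m") (auto simp: L_def intro: Least_le)
  qed
  moreover have "\<exists>i\<le>length \<sigma>. P (set (take i \<sigma>))" "\<exists>i\<le>length \<sigma>. Q (set (take i \<sigma>))"
    using P m iff[of m] by auto
  ultimately show ?thesis by (simp add: hitting_time_def L_def)
qed

lemma copies_mono:
  assumes "E \<subseteq> E'"
  shows "copies VH EH V E \<subseteq> copies VH EH V E'"
proof
  fix C assume "C \<in> copies VH EH V E"
  then obtain f where "inj_on f VH" "f ` VH \<subseteq> V" "\<forall>e\<in>EH. f ` e \<in> E" "C = (f ` VH, (\<lambda>e. f ` e) ` EH)"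
    unfolding copies_iff by blast
  then show "C \<in> copies VH EH V E'"
    unfolding copies_iff using assms by (intro exI[of _ f]) auto
qed

text \<open>Copies only accumulate, so if they are pairwise disjoint at time \<open>m\<close>, they
  are so at every earlier time. A check of the single graph at time \<open>m\<close> therefore
  suffices.\<close>

lemma hitting_times_agree:
  assumes H: "is_graph VH EH" "VH \<noteq> {}" and ab: "a \<ge> 1" "b \<ge> 1" and m: "m \<le> length \<sigma>"
    and disj: "\<And>C D. C \<in> copies VH EH {0..<n} (set (take m \<sigma>)) \<Longrightarrow> D \<in> copies VH EH {0..<n} (set (take m \<sigma>))
      \<Longrightarrow> C \<noteq> D \<Longrightarrow> fst C \<inter> fst D = {}"
    and N: "N = (LEAST M. box_value a b t (card VH) M)" and n: "card VH * N + max a b \<le> n"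
    and cN: "contains_N_copies N VH EH {0..<n} (set (take m \<sigma>))"
  shows "hitting_time \<sigma> (enforcer_wins_game a b t VH EH n) = hitting_time \<sigma> (contains_N_copies N VH EH {0..<n})"
proof (rule hitting_time_cong[OF _ _ m])
  have *: "enforcer_wins_game a b t VH EH n (set (take i \<sigma>)) \<longleftrightarrow> contains_N_copies N VH EH {0..<n} (set (take i \<sigma>))"
    if "i \<le> m" for i
  proof (rule enforcer_wins_iff_contains_least_copies[OF H ab _ _ N n])
    have "set (take i \<sigma>) \<subseteq> set (take m \<sigma>)" using that by (rule set_take_subset_set_take)
    note sub = copies_mono[OF this, of VH EH "{0..<n}"]
    fix C D assume "C \<in> copies VH EH {0..<n} (set (take i \<sigma>))" "D \<in> copies VH EH {0..<n} (set (take i \<sigma>))" "C \<noteq> D"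
    with sub disj show "fst C \<inter> fst D = {}" by blast
  qed simp
  then show "\<And>i. i \<le> m \<Longrightarrow> enforcer_wins_game a b t VH EH n (set (take i \<sigma>)) \<longleftrightarrow> contains_N_copies N VH EH {0..<n} (set (take i \<sigma>))" .
  show "enforcer_wins_game a b t VH EH n (set (take m \<sigma>))" using *[of m] cN by simp
qed

lemma contains_N_copies_of_multi_copy:
  assumes "contains_copy (multi_vertices N VH) (multi_edges N EH) V E" "VH \<noteq> {}" "finite V" "finite E"
  shows "contains_N_copies N VH EH V E"
proof -
  obtain \<V> where "\<V> \<subseteq> fst ` copies VH EH V E" "card \<V> = N"
    using disjoint_copies_of_multi_copy[OF assms(1,2)] by blast
  then have "N \<le> card (fst ` copies VH EH V E)"
    using finite_copies[OF assms(3,4)] by (metis card_mono finite_imageI)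
  also have "\<dots> \<le> card (copies VH EH V E)" using finite_copies[OF assms(3,4)] by (rule card_image_le)
  finally show ?thesis by (simp add: contains_N_copies_def)
qed

text \<open>Cross-multiplied into integers, the strict inequality of densities has a gap of at least
  \<open>1\<close>, independent of the subgraph. This is what bounds the exponent for intersecting
  copies away from \<open>0\<close>.\<close>

lemma strictly_balanced_gap:
  assumes H: "is_graph VH EH" "VH \<noteq> {}" "strictly_balanced VH EH"
    and sub: "subgraph V' E' VH EH" "V' \<noteq> {}" "(V', E') \<noteq> (VH, EH)"
  shows "card VH * card E' < card EH * card V'"
proof -
  have "density V' E' < density VH EH" using H(3) sub by (auto simp: strictly_balanced_def)
  moreover have "card VH > 0" "card V' > 0"
    using H sub by (auto simp: card_gt_0_iff is_graph_def subgraph_def intro: finite_subset)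
  ultimately have "real (card VH) * real (card E') < real (card EH) * real (card V')"
    by (simp add: density_def field_simps)
  then show ?thesis by (simp flip: of_nat_mult)
qed

lemma strictly_balanced_density_le:
  assumes H: "is_graph VH EH" "VH \<noteq> {}" "strictly_balanced VH EH" and sub: "subgraph V' E' VH EH"
  shows "real (card E') \<le> real (card EH) / real (card VH) * real (card V')"
proof -
  consider "V' = {}" | "(V', E') = (VH, EH)" | "V' \<noteq> {}" "(V', E') \<noteq> (VH, EH)" by blast
  then show ?thesis
  proof cases
    case 1
    then have "E' = {}" using subgraph_empty_vertices[OF H(1)] sub by blast
    then show ?thesis by simp
  next
    case 2
    then show ?thesis using H by (simp add: is_graph_def)
  next
    case 3
    then have "card VH * card E' < card EH * card V'" using strictly_balanced_gap[OF H sub] by blast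
    then have "real (card VH) * real (card E') \<le> real (card EH) * real (card V')"
      by (simp flip: of_nat_mult)
    moreover have "card VH > 0" using H by (auto simp: card_gt_0_iff is_graph_def)
    ultimately show ?thesis by (simp add: field_simps)
  qed
qed

text \<open>A single edge has density \<open>1 / 2\<close>, so \<open>H\<close> has at least that.
  In the process this keeps the number of edges at the chosen time growing like a power of
  \<open>n\<close>.\<close>

lemma strictly_balanced_card_le:
  assumes H: "is_graph VH EH" "VH \<noteq> {}" "strictly_balanced VH EH" and "EH \<noteq> {}"
  shows "card VH \<le> 2 * card EH"
proof -
  obtain e where e: "e \<in> EH" using assms by blast
  then have "subgraph e {e} VH EH" "card e = 2" using H(1) by (auto simp: subgraph_def is_graph_def)
  from strictly_balanced_density_le[OF H this(1)] this(2)
  have "1 \<le> real (card EH) / real (card VH) * 2" by simp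
  moreover have "card VH > 0" using H by (auto simp: card_gt_0_iff is_graph_def)
  ultimately have "real (card VH) \<le> real (2 * card EH)" by (simp add: field_simps)
  then show ?thesis by linarith
qed

text \<open>Without edges every nonempty subgraph has density \<open>0\<close>, so strict balance
  leaves only a single vertex. Its copies are the vertices of the board, and both events already
  occur at time \<open>0\<close>.\<close>

lemma process_hitting_times_edgeless:
  assumes H: "is_graph VH EH" "VH \<noteq> {}" "strictly_balanced VH EH" and E: "EH = {}" and ab: "a \<ge> 1" "b \<ge> 1"
    and N: "N = (LEAST M. box_value a b t (card VH) M)"
  shows "(\<lambda>n. process_prob n (\<lambda>\<sigma>. hitting_time \<sigma> (enforcer_wins_game a b t VH EH n)
             = hitting_time \<sigma> (contains_N_copies N VH EH {0..<n}))) \<longlonglongrightarrow> 1"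
proof -
  obtain v where v: "v \<in> VH" using H by blast
  have "VH = {v}"
  proof (rule ccontr)
    assume "VH \<noteq> {v}"
    then have "card VH * card ({} :: nat set set) < card EH * card {v}"
      using v E by (intro strictly_balanced_gap[OF H]) (auto simp: subgraph_def)
    then show False using E by simp
  qed
  have copies: "copies VH EH {0..<n} F = (\<lambda>x. ({x}, {})) ` {0..<n}" for n :: nat and F
  proof (intro equalityI subsetI)
    fix C assume "C \<in> (\<lambda>x. ({x}, {} :: nat set set)) ` {0..<n}"
    then obtain x where "x \<in> {0..<n}" "C = ({x}, {})" by blast
    then show "C \<in> copies VH EH {0..<n} F"
      unfolding copies_iff \<open>VH = {v}\<close> E by (intro exI[of _ "\<lambda>_. x"]) auto
  qed (auto simp: copies_def \<open>VH = {v}\<close> E)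
  have "hitting_time \<sigma> (enforcer_wins_game a b t VH EH n) = hitting_time \<sigma> (contains_N_copies N VH EH {0..<n})"
    if "n \<ge> N + max a b" for n \<sigma>
  proof (rule hitting_times_agree[OF H(1,2) ab, of 0 \<sigma>])
    show "contains_N_copies N VH EH {0..<n} (set (take 0 \<sigma>))"
      unfolding contains_N_copies_def copies using that by (simp add: card_image inj_on_def)
    show "fst C \<inter> fst D = {}" if "C \<in> copies VH EH {0..<n} (set (take 0 \<sigma>))"
      "D \<in> copies VH EH {0..<n} (set (take 0 \<sigma>))" "C \<noteq> D" for C D
      using that unfolding copies by auto
    show "card VH * N + max a b \<le> n" using that \<open>VH = {v}\<close> by simp
  qed (use N in auto)
  then have "eventually (\<lambda>n. process_prob n (\<lambda>\<sigma>. hitting_time \<sigma> (enforcer_wins_game a b t VH EH n)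
             = hitting_time \<sigma> (contains_N_copies N VH EH {0..<n})) = 1) sequentially"
    using finite_pairs by (intro eventually_sequentiallyI[of "N + max a b"]) (simp add: process_prob_def)
  then show ?thesis by (rule tendsto_eventually)
qed

lemma process_hitting_times:
  assumes H: "is_graph VH EH" "VH \<noteq> {}" "strictly_balanced VH EH" and E: "EH \<noteq> {}" and ab: "a \<ge> 1" "b \<ge> 1"
    and N: "N = (LEAST M. box_value a b t (card VH) M)"
  shows "(\<lambda>n. process_prob n (\<lambda>\<sigma>. hitting_time \<sigma> (enforcer_wins_game a b t VH EH n)
             = hitting_time \<sigma> (contains_N_copies N VH EH {0..<n}))) \<longlonglongrightarrow> 1"
proof -
  define k where "k = card VH"
  define e where "e = card EH"
  define d where "d = real e / real k"
  define \<epsilon> where "\<epsilon> = 1 / (4 * real e ^ 2)"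
  define V where "V = multi_vertices (Suc N) VH"
  define F where "F = multi_edges (Suc N) EH"
  have k0: "k > 0" using H by (auto simp: k_def card_gt_0_iff is_graph_def)
  have e0: "e > 0" using H E finite_edges by (auto simp: e_def card_gt_0_iff)
  have d0: "d > 0" using k0 e0 by (simp add: d_def)
  have \<epsilon>0: "\<epsilon> > 0" using e0 by (simp add: \<epsilon>_def)
  have k2e: "k \<le> 2 * e" unfolding k_def e_def by (rule strictly_balanced_card_le[OF H E])
  then have d2: "1 / d \<le> 2" using e0 by (simp add: d_def field_simps)
  have "\<epsilon> \<le> 1 / d"
  proof -
    have "real e \<le> 4 * real e ^ 2 * real k"
    proof -
      have "real e * 1 \<le> real e * (4 * real e * real k)"
      proof (rule mult_left_mono)
        have "1 * 1 \<le> real e * real k" using e0 k0 by (intro mult_mono) auto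
        then show "1 \<le> 4 * real e * real k" by simp
      qed simp
      then show ?thesis by (simp add: power2_eq_square mult_ac)
    qed
    then show ?thesis using e0 by (simp add: \<epsilon>_def d_def field_simps)
  qed
  have VF: "is_graph V F" "V \<noteq> {}"
    using is_graph_multi H by (auto simp: V_def F_def multi_vertices_def)
  have dens: "real (card E') \<le> d * real (card V')" if "subgraph V' E' V F" for V' E'
    using multi_subgraph_density_le[OF H(1) _ _ that[unfolded V_def F_def], of d] strictly_balanced_density_le[OF H] d0
    by (simp add: d_def k_def e_def)
  define C1 where "C1 = (2 ^ (card V * card V) * 4 ^ card V / ((1 / 2) ^ card F)\<^sup>2 :: real)"
  define C2 where "C2 = (2 ^ (k * k) * 2 ^ (2 * e) :: real)"
  define g where "g n = C1 * real n powr (- d * \<epsilon>) + C2 * real n powr (- 1 / (2 * real e))" for n :: nat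
  have lim: "(\<lambda>n::nat. real n powr (- c)) \<longlonglongrightarrow> 0" if "c > 0" for c
    using that by (intro tendsto_neg_powr filterlim_real_sequentially) auto
  have g0: "g \<longlonglongrightarrow> 0"
  proof -
    have "g \<longlonglongrightarrow> C1 * 0 + C2 * 0"
      unfolding g_def using lim[of "d * \<epsilon>"] lim[of "1 / (2 * real e)"] d0 \<epsilon>0 e0
      by (intro tendsto_intros) auto
    then show ?thesis by simp
  qed
  define q0 where "q0 n = real n powr (- 1 / d + \<epsilon>)" for n :: nat
  define M where "M n = card (pairs n)" for n
  define m where "m n = nat \<lceil>real (M n) * q0 n\<rceil>" for n
  \<comment> \<open>Even for the sparsest case \<open>1 / d = 2\<close> the expected number of edges
    grows like \<open>n powr \<epsilon>\<close>, so it eventually exceeds any constant multiple of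
    \<open>card F\<close>.\<close>
  have Mq: "real n powr \<epsilon> / 4 \<le> real (M n) * q0 n" if "n \<ge> 2" for n
  proof -
    have "2 * (n choose 2) = n * (n - 1)" unfolding choose_two by (rule dvd_mult_div_cancel) (cases n, auto)
    then have "2 * real (M n) = real n * real (n - 1)"
      unfolding M_def card_pairs by (metis of_nat_mult of_nat_numeral)
    moreover have "real n * (real n / 2) \<le> real n * real (n - 1)" using that by (intro mult_left_mono) auto
    ultimately have Mn: "real n ^ 2 / 4 \<le> real (M n)" by (simp add: power2_eq_square)
    have "real n ^ 2 * real n powr (-2 + \<epsilon>) = real n powr (2 + (-2 + \<epsilon>))"
      unfolding powr_add[of _ 2] using that by simp
    then have "real n powr \<epsilon> / 4 = real n ^ 2 / 4 * real n powr (-2 + \<epsilon>)" by simp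
    also have "\<dots> \<le> real n ^ 2 / 4 * q0 n"
      unfolding q0_def using that d2 by (intro mult_left_mono powr_mono) auto
    also have "\<dots> \<le> real (M n) * q0 n" using Mn by (intro mult_right_mono) (auto simp: q0_def)
    finally show ?thesis .
  qed
  have "filterlim (\<lambda>n. real n powr \<epsilon>) at_top sequentially"
    using \<epsilon>0 by real_asymp
  then have "eventually (\<lambda>n. 4 * (2 * real (card F) + 1) \<le> real n powr \<epsilon>) sequentially"
    unfolding filterlim_at_top by blast
  then have ev: "eventually (\<lambda>n. 2 * real (card F) + 1 \<le> real n powr \<epsilon> / 4) sequentially"
    by eventually_elim simp
  show ?thesis
  proof (rule tendsto_1_of_complement[OF _ _ g0])
    fix n
    show "process_prob n (\<lambda>\<sigma>. hitting_time \<sigma> (enforcer_wins_game a b t VH EH n)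
             = hitting_time \<sigma> (contains_N_copies N VH EH {0..<n})) \<le> 1"
      unfolding process_prob_def by (intro divide_le_eq_1[THEN iffD2]) (auto intro: card_mono)
  next
    show "eventually (\<lambda>n. 1 - process_prob n (\<lambda>\<sigma>. hitting_time \<sigma> (enforcer_wins_game a b t VH EH n)
             = hitting_time \<sigma> (contains_N_copies N VH EH {0..<n})) \<le> g n) sequentially"
      using ev eventually_ge_at_top[of 2] eventually_ge_at_top[of "2 * card V"]
        eventually_ge_at_top[of "card VH * N + max a b"]
    proof eventually_elim
      case (elim n)
      have n1: "real n \<ge> 1" using elim by simp
      have "q0 n \<le> real n powr 0"
        unfolding q0_def using n1 \<open>\<epsilon> \<le> 1 / d\<close> by (intro powr_mono) auto
      then have q0: "0 < q0 n" "q0 n \<le> 1" using n1 by (auto simp: q0_def)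
      \<comment> \<open>The summand \<open>1\<close> pays for rounding up in \<open>m n\<close>,
        giving \<open>m n\<close> at most twice the unrounded value; \<open>2 * card F\<close> makes
        every numerator \<open>m n - i\<close> at least half of \<open>m n\<close>.\<close>
      have x: "2 * real (card F) + 1 \<le> real (M n) * q0 n" using elim Mq[of n] by linarith
      have M0: "M n > 0" using x q0 by (intro gr0I) auto
      have "real (M n) * q0 n \<le> real (M n)" using q0 by (simp add: mult_left_le)
      then have mM: "m n \<le> M n" unfolding m_def by (simp add: ceiling_le_iff nat_le_iff)
      have m_ge: "real (M n) * q0 n \<le> real (m n)" unfolding m_def by (rule of_nat_ceiling)
      have m_le: "real (m n) \<le> 2 * (real (M n) * q0 n)"
        unfolding m_def using x by linarith
      define q where "q = real (m n) / real (M n)"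
      have q_ge: "q0 n \<le> q" using m_ge M0 by (simp add: q_def field_simps)
      have q_le: "q \<le> 2 * q0 n" using m_le M0 by (simp add: q_def field_simps)
      have qpos: "q > 0" using q_ge q0 by linarith
      let ?\<pi> = "\<lambda>s. \<Prod>i<s. real (m n - i) / real (M n - i)"
      interpret random_edge_set n "permutations_of_set (pairs n)" "\<lambda>_. 1 / fact (card (pairs n))"
        "\<lambda>\<sigma>. set (take (m n) \<sigma>)" ?\<pi> q
        unfolding q_def M_def using mM M0 by (intro random_edge_set_process) (auto simp: M_def)
      \<comment> \<open>The shift \<epsilon> in the exponent is exactly what lifts
        \<open>n * q powr d\<close> from constant order to a power of \<open>n\<close>.\<close>
      have nq: "real n powr (d * \<epsilon>) \<le> real n * q powr d"
      proof -
        have "(- 1 / d + \<epsilon>) * d = -1 + d * \<epsilon>" using d0 by (simp add: field_simps)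
        then have "q0 n powr d = real n powr (-1) * real n powr (d * \<epsilon>)"
          unfolding q0_def powr_powr by (simp only: powr_add)
        then have "real n powr (d * \<epsilon>) = real n * q0 n powr d" using n1 by (simp add: powr_minus_divide)
        also have "\<dots> \<le> real n * q powr d"
          using q_ge q0 d0 by (intro mult_left_mono powr_mono2) auto
        finally show ?thesis .
      qed
      have nd1: "1 \<le> real n powr (d * \<epsilon>)" using n1 d0 \<epsilon>0 by (intro ge_one_powr_ge_zero) auto
      \<comment> \<open>Removing the first \<open>i\<close> draws changes each factor by at most one
        half, hence \<kappa> is \<open>(1 / 2) ^ card F\<close>.\<close>
      have \<kappa>: "(1 / 2) ^ card F * q ^ card F \<le> ?\<pi> (card F)"
      proof -
        have "(1 / 2) ^ card F * q ^ card F = (\<Prod>i<card F. q / 2)"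
          by (simp add: power_divide)
        also have "\<dots> \<le> ?\<pi> (card F)"
        proof (intro prod_mono conjI)
          fix i assume i: "i \<in> {..<card F}"
          have "2 * real (card F) \<le> real (m n)" using x m_ge by linarith
          then have "real (m n) / 2 \<le> real (m n - i)" using i by simp
          moreover have "0 < M n - i" using \<open>2 * real (card F) \<le> real (m n)\<close> i mM by simp
          ultimately have "real (m n) / 2 / real (M n) \<le> real (m n - i) / real (M n - i)"
            by (intro frac_le) auto
          then show "q / 2 \<le> real (m n - i) / real (M n - i)" by (simp add: q_def)
        qed (use qpos in simp)
        finally show ?thesis .
      qed
      have "pr (\<lambda>\<sigma>. \<not> contains_copy V F {0..<n} (set (take (m n) \<sigma>))) \<le> C1 / (real n * q powr d)"
        unfolding C1_def
        by (rule second_moment[OF VF d0 dens _ qpos _ _ \<kappa>]) (use elim nq nd1 in auto)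
      also have "\<dots> \<le> C1 / real n powr (d * \<epsilon>)"
      proof (rule divide_left_mono[OF nq])
        have "0 < real n powr (d * \<epsilon>)" "0 < real n * q powr d" using nq nd1 by linarith+
        then show "0 < real n * q powr d * real n powr (d * \<epsilon>)" by (rule mult_pos_pos[rotated])
      qed (simp add: C1_def)
      also have "\<dots> = C1 * real n powr (- d * \<epsilon>)" by (simp add: powr_minus_divide)
      finally have bad1: "pr (\<lambda>\<sigma>. \<not> contains_copy V F {0..<n} (set (take (m n) \<sigma>))) \<le> C1 * real n powr (- d * \<epsilon>)" .
      have "pr (\<lambda>\<sigma>. \<exists>C\<in>copies VH EH {0..<n} (set (take (m n) \<sigma>)). \<exists>D\<in>copies VH EH {0..<n} (set (take (m n) \<sigma>)).
          C \<noteq> D \<and> fst C \<inter> fst D \<noteq> {}) \<le> 2 ^ (card VH * card VH) * (2 ^ (2 * e) * real n powr (- 1 / (2 * real e)))"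
      proof (rule first_moment_overlapping[OF H(1,2)])
        fix V' E' assume sub: "subgraph V' E' VH EH" "V' \<noteq> {}" "(V', E') \<noteq> (VH, EH)"
        define j where "j = card V'"
        define i where "i = card E'"
        have fin: "finite VH" "finite EH" using H(1) finite_edges by (auto simp: is_graph_def)
        have j: "j \<le> k" using sub fin by (auto simp: j_def k_def subgraph_def intro: card_mono)
        have i: "i \<le> e" using sub fin by (auto simp: i_def e_def subgraph_def intro: card_mono)
        have "k * i < e * j" using strictly_balanced_gap[OF H sub] by (simp add: i_def j_def k_def e_def)
        then have gap: "real k * real i + 1 \<le> real e * real j"
          by (metis Suc_leI add.commute of_nat_Suc of_nat_le_iff of_nat_mult)
        have "q ^ (2 * e - i) \<le> (2 * q0 n) ^ (2 * e - i)" using q_le qpos by (intro power_mono) auto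
        also have "\<dots> = 2 ^ (2 * e - i) * q0 n ^ (2 * e - i)" by (simp add: power_mult_distrib)
        also have "\<dots> \<le> 2 ^ (2 * e) * q0 n ^ (2 * e - i)"
          using q0 by (intro mult_right_mono power_increasing) auto
        also have "q0 n ^ (2 * e - i) = real n powr ((- 1 / d + \<epsilon>) * real (2 * e - i))"
          unfolding q0_def using n1 by (simp add: powr_powr flip: powr_realpow)
        finally have "real n ^ (2 * k - j) * q ^ (2 * e - i)
            \<le> real n ^ (2 * k - j) * (2 ^ (2 * e) * real n powr ((- 1 / d + \<epsilon>) * real (2 * e - i)))"
          by (intro mult_left_mono) auto
        also have "\<dots> = 2 ^ (2 * e) * real n powr (real (2 * k - j) + (- 1 / d + \<epsilon>) * real (2 * e - i))"
          using n1 by (simp add: powr_add powr_realpow)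
        also have "\<dots> \<le> 2 ^ (2 * e) * real n powr (- 1 / (2 * real e))"
        proof (intro mult_left_mono powr_mono n1)
          \<comment> \<open>The terms \<open>2 * k\<close> and \<open>2 * e / d\<close> cancel. By
            the integer gap the first quotient is at most \<open>- 1 / e\<close>, and
            \<open>\<epsilon> * (2 * e) = 1 / (2 * e)\<close> uses up half of it.\<close>
          have "real (2 * k - j) + (- 1 / d + \<epsilon>) * real (2 * e - i)
              = (real k * real i - real e * real j) / real e + \<epsilon> * (2 * real e - real i)"
            using i j e0 k0 by (simp add: d_def of_nat_diff field_simps)
          also have "\<dots> \<le> - 1 / real e + \<epsilon> * (2 * real e)"
            using gap e0 \<epsilon>0 by (intro add_mono divide_right_mono mult_left_mono) auto
          also have "\<dots> = - 1 / (2 * real e)"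
            using e0 by (simp add: \<epsilon>_def field_simps power2_eq_square)
          finally show "real (2 * k - j) + (- 1 / d + \<epsilon>) * real (2 * e - i) \<le> - 1 / (2 * real e)" .
        qed simp
        finally show "real n ^ (2 * card VH - card V') * q ^ (2 * card EH - card E')
            \<le> 2 ^ (2 * e) * real n powr (- 1 / (2 * real e))"
          by (simp add: i_def j_def k_def e_def)
      qed simp
      then have bad2: "pr (\<lambda>\<sigma>. \<exists>C\<in>copies VH EH {0..<n} (set (take (m n) \<sigma>)). \<exists>D\<in>copies VH EH {0..<n} (set (take (m n) \<sigma>)).
          C \<noteq> D \<and> fst C \<inter> fst D \<noteq> {}) \<le> C2 * real n powr (- 1 / (2 * real e))"
        by (simp add: C2_def k_def mult.assoc)
      let ?good = "\<lambda>\<sigma>. hitting_time \<sigma> (enforcer_wins_game a b t VH EH n) = hitting_time \<sigma> (contains_N_copies N VH EH {0..<n})"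
      have "pr (\<lambda>\<sigma>. \<not> ?good \<sigma>) \<le> pr (\<lambda>\<sigma>. \<not> contains_copy V F {0..<n} (set (take (m n) \<sigma>)) \<or>
          (\<exists>C\<in>copies VH EH {0..<n} (set (take (m n) \<sigma>)). \<exists>D\<in>copies VH EH {0..<n} (set (take (m n) \<sigma>)).
          C \<noteq> D \<and> fst C \<inter> fst D \<noteq> {}))"
      proof (rule pr_mono, rule ccontr)
        fix \<sigma> assume \<sigma>: "\<sigma> \<in> permutations_of_set (pairs n)" and bad: "\<not> ?good \<sigma>"
          and *: "\<not> (\<not> contains_copy V F {0..<n} (set (take (m n) \<sigma>)) \<or>
          (\<exists>C\<in>copies VH EH {0..<n} (set (take (m n) \<sigma>)). \<exists>D\<in>copies VH EH {0..<n} (set (take (m n) \<sigma>)).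
          C \<noteq> D \<and> fst C \<inter> fst D \<noteq> {}))"
        have cN: "contains_N_copies (Suc N) VH EH {0..<n} (set (take (m n) \<sigma>))"
          using * H(2) by (intro contains_N_copies_of_multi_copy) (auto simp: V_def F_def)
        have "?good \<sigma>"
        proof (rule hitting_times_agree[OF H(1,2) ab _ _ N elim(4)])
          show "m n \<le> length \<sigma>" using mM length_finite_permutations_of_set[OF \<sigma>] by (simp add: M_def)
          show "contains_N_copies N VH EH {0..<n} (set (take (m n) \<sigma>))"
            using cN by (simp add: contains_N_copies_def)
        qed (use * in blast)
        with bad show False ..
      qed
      also have "\<dots> \<le> g n"
        unfolding g_def by (rule order_trans[OF pr_disj_le add_mono[OF bad1 bad2]])
      finally have "pr (\<lambda>\<sigma>. \<not> ?good \<sigma>) \<le> g n" .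
      moreover have "process_prob n ?good = pr ?good" unfolding process_prob_eq pr_def by simp
      ultimately show ?case using pr_not[of ?good] by simp
    qed
  qed
qed

theorem theorem6:
  fixes a b :: nat and first :: player
  assumes "a \<ge> 1" and "b \<ge> 1"
  shows
   "(\<forall>VH EH. is_graph VH EH \<and> VH \<noteq> {} \<and> EH \<noteq> {} \<longrightarrow>
       (\<forall>p :: nat \<Rightarrow> real. (\<forall>n. 0 \<le> p n \<and> p n \<le> 1) \<longrightarrow>
          (\<lambda>n. real n powr (- 1 / max_density VH EH)) \<in> o(p) \<longrightarrow>
          (\<lambda>n. gnp_prob n (p n) (enforcer_wins_game a b first VH EH n))
            \<longlonglongrightarrow> 1)
     \<and> (\<forall>p :: nat \<Rightarrow> real. (\<forall>n. 0 \<le> p n \<and> p n \<le> 1) \<longrightarrow>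
          p \<in> o(\<lambda>n. real n powr (- 1 / max_density VH EH)) \<longrightarrow>
          (\<lambda>n. gnp_prob n (p n) (\<lambda>E. \<not> enforcer_wins_game a b first VH EH n E))
            \<longlonglongrightarrow> 1))
    \<and> (\<forall>k. \<exists>N::nat. \<forall>VH EH. is_graph VH EH \<and> VH \<noteq> {} \<and> card VH = k
           \<and> strictly_balanced VH EH \<longrightarrow>
         (\<lambda>n. process_prob n (\<lambda>\<sigma>.
             hitting_time \<sigma> (enforcer_wins_game a b first VH EH n)
             = hitting_time \<sigma> (contains_N_copies N VH EH {0..<n}))) \<longlonglongrightarrow> 1)"
proof (intro conjI allI impI)
  fix k
  show "\<exists>N::nat. \<forall>VH EH. is_graph VH EH \<and> VH \<noteq> {} \<and> card VH = k \<and> strictly_balanced VH EH \<longrightarrow>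
         (\<lambda>n. process_prob n (\<lambda>\<sigma>.
             hitting_time \<sigma> (enforcer_wins_game a b first VH EH n)
             = hitting_time \<sigma> (contains_N_copies N VH EH {0..<n}))) \<longlonglongrightarrow> 1"
  \<comment> \<open>The witness refers to \<open>H\<close> only through \<open>k\<close>, so one
    \<open>N\<close> serves all strictly balanced graphs on \<open>k\<close> vertices.\<close>
  proof (intro exI[of _ "LEAST M. box_value a b first k M"] allI impI, elim conjE)
    fix VH :: "nat set" and EH assume H: "is_graph VH EH" "VH \<noteq> {}" "card VH = k" "strictly_balanced VH EH"
    let ?N = "LEAST M. box_value a b first k M"
    have N: "?N = (LEAST M. box_value a b first (card VH) M)" using H(3) by simp
    show "(\<lambda>n. process_prob n (\<lambda>\<sigma>. hitting_time \<sigma> (enforcer_wins_game a b first VH EH n)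
             = hitting_time \<sigma> (contains_N_copies ?N VH EH {0..<n}))) \<longlonglongrightarrow> 1"
      using process_hitting_times[OF H(1,2,4) _ assms N] process_hitting_times_edgeless[OF H(1,2,4) _ assms N]
      by (cases "EH = {}") simp_all
  qed
qed (use gnp_enforcer_wins[OF assms] gnp_avoider_wins in blast)+

end
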